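(* For each positive integer $n$ let $X_n$ be the number of permutations needed for the shuffling-and-merging process started from $[n]$ to end, and let $\mu_n=\mathbf{E}[X_n]$. For every integer $m\ge 2$, as $n\to+\infty$, $$\mathbf{E}\big[(X_n-\mu_n)^m\big]=\begin{cases}(2M-1)!!\cdot n^M+O(n^{M-1}\log n), & \text{if } m=2M,\\[2pt] \tfrac{2}{3}M(2M+1)!!\cdot n^M+O(n^{M-1}\log n), & \text{if } m=2M+1,\end{cases}$$ where the implied constants depend only on $m$. Furthermore, if we define $$\varepsilon^{(m)}_n:=\mathbf{E}\big[(X_n-\mu_n)^m\big]-\begin{cases}(2M-1)!!\cdot n^M, & \text{if } m=2M,\\[2pt] \tfrac{2}{3}M(2M+1)!!\cdot n^M, & \text{if } m=2M+1,\end{cases}$$ then, as $n\to+\infty$, $$\big|\varepsilon^{(m)}_n-\varepsilon^{(m)}_{n-1}\big|=\begin{cases}O(n^{-1}), & \text{if } m=2\text{ or }3,\\[2pt] O\big(n^{\lfloor m/2\rfloor-2}\log n\big), & \text{if } m\ge 4.\end{cases}$$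
   Context: The process. For a positive integer $n$, take a uniformly random permutation $\tau=(\tau(1),\ldots,\tau(n))$ of $[n]=\{1,2,\ldots,n\}$. A block of $\tau$ is a maximal sequence of (increasing) consecutive integers $a,a+1,\ldots,a+r$ ($r\ge 0$) that appear, in this order, in adjacent positions of $\tau$. For example, the blocks of $(1,7,5,6,8,10,9,2,3,4)$ are $(1),(7),(5,6),(8),(10),(9),(2,3,4)$. Each block is merged into its first integer, and after all the merges the elements of the new set are relabeled from $1$ to the current number of elements, giving $[k]$ where $k$ is the number of blocks. One then takes a new, independent, uniformly random permutation of $[k]$, merges again, and so on, until only one integer is left. $X_n$ is the number of permutations used until the process ends; by convention $X_1=0$. Equivalently, for $n\ge 2$, $X_n$ has the law of $1+\widetilde X_{Y_n}$, where $Y_n$ is the number of blocks in a uniformly random permutation of $[n]$ and the $\widetilde X_k$ ($1\le k\le n$) are independent of $Y_n$ and of each other, with $\widetilde X_k$ distributed as $X_k$. Double factorial: $n!!:=n(n-2)(n-4)\cdots$ (product of the positive terms). $f(n)=O(g(n))$ means $|f(n)|\le C g(n)$ for a constant $C$ and all sufficiently large $n$. *)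

theory Defs
  imports
    "HOL-Probability.Probability"
    "HOL-Combinatorics.Multiset_Permutations"
    "HOL-Library.Sublist"
    "HOL-Library.Landau_Symbols"
begin

text \<open>A permutation of \<open>[n]\<close> is written as the list of its values, that is, as an element of
  \<^term>\<open>permutations_of_set {1..n::nat}\<close>. Adjacency of positions is \<^term>\<open>sublist\<close>, which
  stands for contiguous sublists.\<close>

definition consecutive :: "nat list \<Rightarrow> bool" where
  "consecutive bs \<longleftrightarrow> (\<exists>a r. bs = [a..<Suc (a + r)])"

definition blocks :: "nat list \<Rightarrow> nat list set" where
  "blocks \<tau> = {bs. consecutive bs \<and> sublist bs \<tau> \<and>
     (\<forall>cs. consecutive cs \<and> sublist cs \<tau> \<and> sublist bs cs \<longrightarrow> cs = bs)}"

definition random_permutation :: "nat \<Rightarrow> nat list pmf" where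
  "random_permutation n = pmf_of_set (permutations_of_set {1..n})"

text \<open>The source of randomness: for every step \<open>t\<close> and every \<open>k\<close>, independently, a uniformly random
  permutation \<open>(\<omega> !! t) k\<close> of \<open>[k]\<close>. If the current set at time \<open>t\<close> is \<open>[k]\<close>, only
  \<open>(\<omega> !! t) k\<close> is used in step \<open>t\<close>.\<close>

definition shuffles_space :: "(nat \<Rightarrow> nat list) stream measure" where
  "shuffles_space = stream_space (\<Pi>\<^sub>M k\<in>UNIV. measure_pmf (random_permutation k))"

text \<open>Merging every block into its first integer and relabelling turns \<open>[k]\<close> into
  \<open>[k']\<close>, where \<open>k'\<close> is the number of blocks; so the state of the process is the
  current number of elements.\<close>

primrec elements_left :: "nat \<Rightarrow> (nat \<Rightarrow> nat list) stream \<Rightarrow> nat \<Rightarrow> nat" where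
  "elements_left n \<omega> 0 = n"
| "elements_left n \<omega> (Suc t) = card (blocks ((\<omega> !! t) (elements_left n \<omega> t)))"

text \<open>The value is unspecified on the (null) event that the process never ends.\<close>

definition X :: "nat \<Rightarrow> (nat \<Rightarrow> nat list) stream \<Rightarrow> nat" where
  "X n \<omega> = (LEAST t. elements_left n \<omega> t = 1)"

definition \<mu> :: "nat \<Rightarrow> real" where
  "\<mu> n = (\<integral>\<omega>. real (X n \<omega>) \<partial>shuffles_space)"

definition central_moment :: "nat \<Rightarrow> nat \<Rightarrow> real" where
  "central_moment m n = (\<integral>\<omega>. (real (X n \<omega>) - \<mu> n) ^ m \<partial>shuffles_space)"

fun double_factorial :: "nat \<Rightarrow> nat" where
  "double_factorial 0 = 1"
| "double_factorial (Suc 0) = 1"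
| "double_factorial (Suc (Suc n)) = Suc (Suc n) * double_factorial n"

definition main_term :: "nat \<Rightarrow> nat \<Rightarrow> real" where
  "main_term m n = (let M = m div 2 in
     if even m then real (double_factorial (2 * M - 1)) * real n ^ M
     else 2 / 3 * real M * real (double_factorial (2 * M + 1)) * real n ^ M)"

definition \<epsilon> :: "nat \<Rightarrow> nat \<Rightarrow> real" where
  "\<epsilon> m n = central_moment m n - main_term m n"

end

theory Submission
  imports Defs
begin

text \<open>The number of blocks of a permutation of \<open>[n]\<close> is \<open>n - Z\<close>, where \<open>Z\<close> counts the successions
  (adjacent positions carrying \<open>a, a + 1\<close>). Inserting \<open>n + 1\<close> into a permutation of \<open>[n]\<close> gives a
  recursion from which \<open>E (Z choose k) = (1 - k / n) / k!\<close> for \<open>k \<le> n\<close>, so \<open>Z\<close> is Poisson(1) up to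
  \<open>O(1 / n)\<close>. If \<open>h n - E h(n - Z) = r n\<close>, then the increments \<open>h n - h (n - 1)\<close> are as small as \<open>r\<close>,
  because \<open>P(Z \<ge> 1) > 1 / 2\<close> makes the recursion for the increments a contraction. For the mean
  this yields increments \<open>1 + O(1 / n)\<close>. For the central moments \<open>C m\<close>, write
  \<open>C m n = E (\<Sum>j\<le>m. (m choose j) * C j (n - Z) * D ^ (m - j))\<close> with \<open>D = 1 + \<mu> (n - Z) - \<mu> n \<approx> 1 - Z\<close>
  and \<open>E D = 0\<close>. By induction on \<open>m\<close> only \<open>j \<ge> m - 3\<close> matters, these terms are computed from
  \<open>E (1 - Z)^2 \<approx> 1\<close>, \<open>E (1 - Z)^3 \<approx> -1\<close> and \<open>E (Z (Z - 1)) \<approx> 1\<close>, and they match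
  \<open>main_term m n - E (main_term m (n - Z))\<close>.\<close>

subsection \<open>Successions and blocks\<close>

text \<open>The operator \<open>h n - E h(n - Z)\<close> annihilates constants, so it controls
  increments and not values; one increment estimate then serves both the mean and the errors of all
  moments. Increments are also what the induction consumes. In the term \<open>j = m - 1\<close> the
  factor \<open>D\<close> is centred, so \<open>C j n\<close> may be subtracted from
  \<open>C j (n - Z)\<close> without changing the mean, and this gains one order. Bounds on the size
  of \<open>C j\<close> alone would lose that gain and the induction would not close. Values are
  recovered by summing increments. The harmonic sum of the rate \<open>1 / n\<close> is the origin
  of the logarithm: it enters the values for \<open>m = 2, 3\<close> and from there the increments
  for \<open>m \<ge> 4\<close>. Estimates are needed at all points \<open>n - z\<close>; they are
  allowed a factor polynomial in \<open>z\<close>, because an exponential moment of \<open>Z\<close>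
  is bounded uniformly in \<open>n\<close>. The recursions for the moments presuppose that the
  process ends almost surely and that all moments are finite, which comes from an exponential tail
  bound.\<close>

fun successions :: "nat list \<Rightarrow> nat" where
  "successions [] = 0"
| "successions [x] = 0"
| "successions (x # y # zs) = of_bool (y = Suc x) + successions (y # zs)"

lemma successions_less_length: "xs \<noteq> [] \<Longrightarrow> successions xs < length xs"
  by (induction xs rule: successions.induct) auto

lemma sublist_pair_Cons_iff: "sublist [a, b] (x # xs) \<longleftrightarrow> (a = x \<and> xs \<noteq> [] \<and> hd xs = b) \<or> sublist [a, b] xs"
  by (cases xs) (auto simp: sublist_Cons_right)

lemma sublist_pair_memD: "sublist [a, b] xs \<Longrightarrow> a \<in> set xs \<and> b \<in> set xs"
  using set_mono_sublist by fastforce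

text \<open>Without repetitions a value has at most one left neighbour, so counting the pairs by
  their upper entry loses nothing.\<close>

lemma card_succession_tops:
  "distinct xs \<Longrightarrow> card {x. \<exists>y. x = Suc y \<and> sublist [y, x] xs} = successions xs"
proof (induction xs rule: successions.induct)
  case 1
  then show ?case by simp
next
  case (2 x)
  then show ?case by (auto simp: sublist_pair_Cons_iff)
next
  case (3 x y zs)
  have fin: "finite {x. \<exists>y'. x = Suc y' \<and> sublist [y', x] (y # zs)}"
    by (rule finite_subset[of _ "set (y # zs)"]) (auto dest: sublist_pair_memD)
  \<comment> \<open>The head \<open>y\<close> occurs only once, so it is not also the top of a later
    pair.\<close>
  have nosub: "\<not> sublist [y', y] (y # zs)" for y'
  proof
    assume "sublist [y', y] (y # zs)"
    then obtain us vs where eq: "y # zs = us @ [y', y] @ vs"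
      unfolding sublist_def by blast
    from eq have "y \<in> set zs" by (cases us) auto
    with 3 show False by simp
  qed
  have "{x'. \<exists>y'. x' = Suc y' \<and> sublist [y', x'] (x # y # zs)}
      = (if y = Suc x then {y} else {}) \<union> {x. \<exists>y'. x = Suc y' \<and> sublist [y', x] (y # zs)}"
    by (subst sublist_pair_Cons_iff) auto
  with 3 fin nosub show ?case by (auto simp: card_insert_if)
qed

lemma sublist_upt_iff:
  "sublist [a..<Suc (a + r)] [b..<Suc (b + s)] \<longleftrightarrow> b \<le> a \<and> a + r \<le> b + s"
proof
  assume "sublist [a..<Suc (a + r)] [b..<Suc (b + s)]"
  then have "set [a..<Suc (a + r)] \<subseteq> set [b..<Suc (b + s)]"
    by (rule set_mono_sublist)
  moreover have "a \<in> set [a..<Suc (a + r)]" "a + r \<in> set [a..<Suc (a + r)]" by auto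
  ultimately have "a \<in> set [b..<Suc (b + s)]" "a + r \<in> set [b..<Suc (b + s)]" by blast+
  then show "b \<le> a \<and> a + r \<le> b + s" by auto
next
  assume *: "b \<le> a \<and> a + r \<le> b + s"
  have "[b..<Suc (b + s)] = [b..<a] @ [a..<Suc (b + s)]"
    using * upt_add_eq_append[of b a "Suc (b + s) - a"] by simp
  also have "[a..<Suc (b + s)] = [a..<Suc (a + r)] @ [Suc (a + r)..<Suc (b + s)]"
    using * upt_add_eq_append[of a "Suc (a + r)" "Suc (b + s) - Suc (a + r)"] by simp
  finally show "sublist [a..<Suc (a + r)] [b..<Suc (b + s)]"
    unfolding sublist_def by blast
qed

lemma hd_upt_Suc: "hd [a..<Suc (a + r)] = a"
  by (simp add: upt_conv_Cons del: upt_Suc)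

text \<open>Two intervals with the same first element are comparable, and maximality makes
  comparable blocks equal. Blocks can thus be counted by their first elements.\<close>

lemma inj_on_hd_blocks: "inj_on hd (blocks xs)"
proof (rule inj_onI)
  fix b c assume b: "b \<in> blocks xs" and c: "c \<in> blocks xs" and eq: "hd b = hd c"
  obtain a r a' s where "b = [a..<Suc (a + r)]" "c = [a'..<Suc (a' + s)]"
    using b c unfolding blocks_def consecutive_def by blast
  moreover from this eq have "a = a'" by (simp only: hd_upt_Suc)
  ultimately have "sublist b c \<or> sublist c b"
    by (simp only: sublist_upt_iff) linarith
  with b c show "b = c" unfolding blocks_def by blast
qed

text \<open>A block whose first element had its predecessor directly on the left could be extended.
  Conversely, if this neighbour is missing, the longest run to the right cannot be extended on
  either side.\<close>

lemma hd_image_blocks: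
  assumes "distinct xs"
  shows "hd ` blocks xs = set xs - {x. \<exists>y. x = Suc y \<and> sublist [y, x] xs}"
proof (intro equalityI subsetI)
  fix x assume "x \<in> hd ` blocks xs"
  then obtain b where b: "b \<in> blocks xs" and x: "x = hd b" by blast
  then obtain a r where bdef: "b = [a..<Suc (a + r)]" unfolding blocks_def consecutive_def by blast
  have xa: "x = a" unfolding x bdef by (rule hd_upt_Suc)
  obtain us vs where xs: "xs = us @ b @ vs" using b unfolding blocks_def sublist_def by blast
  have bC: "b = x # [Suc x..<Suc (x + r)]" unfolding bdef xa by (simp add: upt_conv_Cons del: upt_Suc)
  have "\<not> sublist [y, x] xs" if y: "x = Suc y" for y
  proof
    assume "sublist [y, x] xs"
    then obtain us' vs' where xs': "xs = us' @ [y, x] @ vs'" unfolding sublist_def by blast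
    \<comment> \<open>As \<open>x\<close> occurs only once, both decompositions split at the same
      place, so \<open>y\<close> stands directly before \<open>b\<close>.\<close>
    have "(us' @ [y]) @ x # vs' = us @ x # ([Suc x..<Suc (x + r)] @ vs)"
      using xs xs' bC by simp
    moreover have "x \<notin> set (us' @ [y])"
      using assms unfolding xs' by auto
    moreover have "x \<notin> set us"
      using assms unfolding xs bC by auto
    moreover have "x \<notin> set vs'" using assms xs' by auto
    ultimately have "us = us' @ [y]" by (metis append_Cons_eq_iff)
    then have "xs = us' @ (y # b) @ vs" using xs by simp
    then have "sublist (y # b) xs" unfolding sublist_def by blast
    moreover have "y # b = [y..<Suc (y + Suc r)]"
      unfolding bdef using upt_conv_Cons[of y "Suc (y + Suc r)"] xa[symmetric] y by simp
    then have "consecutive (y # b)" unfolding consecutive_def by blast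
    moreover have "sublist b (y # b)" by (simp add: sublist_Cons_right)
    ultimately have "y # b = b" using b unfolding blocks_def by blast
    then show False by simp
  qed
  moreover have "x \<in> set xs" using xs bC by simp
  ultimately show "x \<in> set xs - {x. \<exists>y. x = Suc y \<and> sublist [y, x] xs}" by blast
next
  fix x assume x: "x \<in> set xs - {x. \<exists>y. x = Suc y \<and> sublist [y, x] xs}"
  define P where "P r \<longleftrightarrow> sublist [x..<Suc (x + r)] xs" for r
  have P0: "P 0" using x unfolding P_def sublist_def by (fastforce simp: in_set_conv_decomp)
  have Pb: "r \<le> length xs" if "P r" for r
    using sublist_length_le[of "[x..<Suc (x + r)]" xs] that unfolding P_def by simp
  define r where "r = (GREATEST r. P r)"
  have r: "P r" unfolding r_def by (rule GreatestI_nat[of _ 0 "length xs"]) (use P0 Pb in auto)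
  have rmax: "s \<le> r" if "P s" for s
    unfolding r_def by (rule Greatest_le_nat[of _ _ "length xs"]) (use that Pb in auto)
  have "[x..<Suc (x + r)] \<in> blocks xs"
    unfolding blocks_def
  proof (intro CollectI conjI allI impI)
    show "consecutive [x..<Suc (x + r)]" unfolding consecutive_def by blast
    show "sublist [x..<Suc (x + r)] xs" using r unfolding P_def .
    fix cs assume *: "consecutive cs \<and> sublist cs xs \<and> sublist [x..<Suc (x + r)] cs"
    then obtain a s where cs: "cs = [a..<Suc (a + s)]" unfolding consecutive_def by blast
    have le: "a \<le> x" "x + r \<le> a + s" using * unfolding cs sublist_upt_iff by auto
    have "\<not> a < x"
    proof
      assume "a < x"
      then obtain y where y: "x = Suc y" "a \<le> y" by (cases x) auto
      have "sublist [y..<Suc (y + 1)] cs" unfolding cs sublist_upt_iff using y le by simp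
      then have "sublist [y, x] xs" using * y by (simp add: sublist_order.order.trans)
      with x y show False by blast
    qed
    with le have a: "a = x" by simp
    then have "s \<le> r" using * rmax[of s] unfolding P_def cs by blast
    with le a show "cs = [x..<Suc (x + r)]" unfolding cs by simp
  qed
  moreover have "hd [x..<Suc (x + r)] = x" by (rule hd_upt_Suc)
  ultimately show "x \<in> hd ` blocks xs" by force
qed

lemma card_blocks:
  assumes "distinct xs"
  shows "card (blocks xs) = length xs - successions xs"
proof -
  have "card (blocks xs) = card (hd ` blocks xs)"
    by (rule card_image[OF inj_on_hd_blocks, symmetric])
  also have "\<dots> = card (set xs) - card {x. \<exists>y. x = Suc y \<and> sublist [y, x] xs}"
    unfolding hd_image_blocks[OF assms]
    by (rule card_Diff_subset) (auto dest: sublist_pair_memD intro: finite_subset[of _ "set xs"])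
  finally show ?thesis
    using assms by (simp add: card_succession_tops distinct_card)
qed

subsection \<open>Factorial moments of the number of successions\<close>

text \<open>Inserting the maximum \<open>N\<close> right after \<open>N - 1\<close> creates a
  succession, inserting it inside a succession destroys that one, and all other gaps are neutral.
  The front gap is left out so that the first entry stays fixed during the induction.\<close>

lemma sum_successions_insert_Cons:
  fixes g :: "nat \<Rightarrow> real"
  assumes "distinct (x # xs)" "N \<notin> set (x # xs)" "\<And>y. y \<in> set (x # xs) \<Longrightarrow> y \<le> N" "N > 0"
  shows "(\<Sum>i\<le>length xs. g (successions (x # take i xs @ N # drop i xs))) =
     of_bool (N - 1 \<in> set (x # xs)) * g (Suc (successions (x # xs)))
     + real (successions (x # xs)) * g (successions (x # xs) - 1)
     + (real (length (x # xs)) - of_bool (N - 1 \<in> set (x # xs)) - real (successions (x # xs)))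
         * g (successions (x # xs))"
  using assms
proof (induction xs arbitrary: x g)
  case Nil
  then show ?case by (auto simp: of_bool_def)
next
  case (Cons y ys)
  define z where "z = successions (y # ys)"
  define a :: real where "a = of_bool (N - 1 \<in> set (y # ys))"
  have yN: "y < N" using Cons.prems by force
  have first: "successions (x # N # y # ys) = of_bool (N = Suc x) + z" using yN by (simp add: z_def)
  \<comment> \<open>Used with \<open>h\<close> equal to \<open>g\<close> shifted by the contribution
    of the pair at the head; hence the induction over arbitrary \<open>g\<close>.\<close>
  have IH: "(\<Sum>i\<le>length ys. h (successions (y # take i ys @ N # drop i ys))) =
     a * h (Suc z) + real z * h (z - 1) + (real (Suc (length ys)) - a - real z) * h z" for h :: "nat \<Rightarrow> real"
    using Cons.IH[of y h] Cons.prems by (simp add: a_def z_def)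
  have *: "(\<Sum>i\<le>length (y # ys). g (successions (x # take i (y # ys) @ N # drop i (y # ys))))
    = g (of_bool (N = Suc x) + z)
      + (\<Sum>i\<le>length ys. g (of_bool (y = Suc x) + successions (y # take i ys @ N # drop i ys)))"
    unfolding length_Cons
    by (subst sum.atMost_Suc_shift)
      (simp only: take_0 drop_0 append_Nil first take_Suc_Cons drop_Suc_Cons append_Cons successions.simps(3)[of x y])
  have zx: "successions (x # y # ys) = of_bool (y = Suc x) + z" by (simp add: z_def)
  show ?case
  proof (cases "N = Suc x")
    case True
    then have "y \<noteq> Suc x" "a = 0" using Cons.prems by (auto simp: a_def)
    with True show ?thesis
      unfolding * zx by (subst IH) (simp add: algebra_simps)
  next
    case False
    have a: "of_bool (N - 1 \<in> set (x # y # ys)) = a"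
      using False Cons.prems(4) by (auto simp: a_def)
    show ?thesis
    proof (cases "y = Suc x")
      case True
      \<comment> \<open>At \<open>z = 0\<close> truncated subtraction makes the arguments differ,
        but there the factor \<open>real z\<close> vanishes.\<close>
      have "real z * g (Suc (z - 1)) = real z * g z" by (cases z) auto
      then show ?thesis unfolding * zx a using False True
        by (subst IH) (simp add: algebra_simps)
    next
      case y: False
      show ?thesis unfolding * zx a using False y
        by (subst IH) (simp add: algebra_simps)
    qed
  qed
qed

text \<open>The front gap is neutral, since a maximum followed by a smaller number is no succession.
  For \<open>n \<ge> 1\<close> the value \<open>n\<close> is present, so exactly one gap creates a
  succession.\<close>

lemma sum_successions_insert:
  fixes g :: "nat \<Rightarrow> real"
  assumes \<sigma>: "\<sigma> \<in> permutations_of_set {1..n}" and n: "n \<ge> 1"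
  shows "(\<Sum>i\<le>n. g (successions (take i \<sigma> @ Suc n # drop i \<sigma>))) =
     g (Suc (successions \<sigma>)) + real (successions \<sigma>) * g (successions \<sigma> - 1)
     + (real n - real (successions \<sigma>)) * g (successions \<sigma>)"
proof -
  have len: "length \<sigma> = n" and set: "set \<sigma> = {1..n}" and dist: "distinct \<sigma>"
    using \<sigma> length_finite_permutations_of_set[OF \<sigma>] by (auto simp: permutations_of_set_def)
  obtain x xs where x: "\<sigma> = x # xs" using len n by (cases \<sigma>) auto
  obtain k where k: "n = Suc k" "length xs = k" using len n x by (cases n) auto
  have "x \<le> n" using set x by (metis atLeastAtMost_iff list.set_intros(1))
  then have first: "successions (Suc n # \<sigma>) = successions \<sigma>"
    using x by simp
  have mem: "n \<in> set (x # xs)" using set n x by simp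
  have sub: "set (x # xs) = {1..n}" using set x by simp
  have "(\<Sum>i\<le>n. g (successions (take i \<sigma> @ Suc n # drop i \<sigma>)))
    = g (successions \<sigma>) + (\<Sum>i\<le>length xs. g (successions (x # take i xs @ Suc n # drop i xs)))"
    unfolding k(1) by (subst sum.atMost_Suc_shift) (use first in \<open>simp add: x k(2) k(1)\<close>)
  also have "\<dots> = g (Suc (successions \<sigma>)) + real (successions \<sigma>) * g (successions \<sigma> - 1)
     + (real n - real (successions \<sigma>)) * g (successions \<sigma>)"
  proof (subst sum_successions_insert_Cons)
    show "distinct (x # xs)" using dist x by simp
    show "Suc n \<notin> set (x # xs)" unfolding sub by simp
    show "\<And>y. y \<in> set (x # xs) \<Longrightarrow> y \<le> Suc n" unfolding sub by simp
  qed (use mem in \<open>auto simp: x[symmetric] len k algebra_simps\<close>)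
  finally show ?thesis .
qed

text \<open>Surjectivity is obtained by counting, as \<open>n! * (n + 1) = (n + 1)!\<close>; only
  injectivity and the range need an argument.\<close>

lemma bij_betw_insert_max:
  "bij_betw (\<lambda>(\<sigma>, i). take i \<sigma> @ Suc n # drop i \<sigma>)
     (permutations_of_set {1..n} \<times> {..n}) (permutations_of_set {1..Suc n})"
proof -
  let ?f = "\<lambda>(\<sigma>, i). take i \<sigma> @ Suc n # drop i \<sigma>"
  let ?A = "permutations_of_set {1..n} \<times> {..n}" and ?B = "permutations_of_set {1..Suc n}"
  have props: "length \<sigma> = n" "set \<sigma> = {1..n}" "distinct \<sigma>" if "\<sigma> \<in> permutations_of_set {1..n}" for \<sigma>
    using that length_finite_permutations_of_set[OF that] by (auto simp: permutations_of_set_def)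
  have inj: "inj_on ?f ?A"
  proof (rule inj_onI, clarify)
    fix \<sigma> i \<sigma>' i'
    assume P: "\<sigma> \<in> permutations_of_set {1..n}" "\<sigma>' \<in> permutations_of_set {1..n}" and i: "i \<le> n" "i' \<le> n"
      and eq: "take i \<sigma> @ Suc n # drop i \<sigma> = take i' \<sigma>' @ Suc n # drop i' \<sigma>'"
    have N: "Suc n \<notin> set \<sigma>" "Suc n \<notin> set \<sigma>'" using props P by auto
    then have "Suc n \<notin> set (take i \<sigma>)" "Suc n \<notin> set (drop i \<sigma>)"
      "Suc n \<notin> set (take i' \<sigma>')" "Suc n \<notin> set (drop i' \<sigma>')"
      by (auto dest: in_set_takeD in_set_dropD)
    with eq have e: "take i \<sigma> = take i' \<sigma>'" "drop i \<sigma> = drop i' \<sigma>'"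
      by (auto simp: append_Cons_eq_iff)
    from e(1) have "length (take i \<sigma>) = length (take i' \<sigma>')" by simp
    then have "i = i'" using props P i by simp
    moreover have "\<sigma> = \<sigma>'" using e by (metis append_take_drop_id)
    ultimately show "\<sigma> = \<sigma>' \<and> i = i'" by simp
  qed
  have img: "?f ` ?A \<subseteq> ?B"
  proof clarify
    fix \<sigma> i assume P: "\<sigma> \<in> permutations_of_set {1..n}" "i \<le> n"
    have un: "set (take i \<sigma>) \<union> set (drop i \<sigma>) = {1..n}"
      using props[OF P(1)] by (metis append_take_drop_id set_append)
    have "distinct (take i \<sigma> @ drop i \<sigma>)" using props[OF P(1)] by simp
    then have "set (take i \<sigma>) \<inter> set (drop i \<sigma>) = {}" by (simp only: distinct_append)
    then show "take i \<sigma> @ Suc n # drop i \<sigma> \<in> ?B"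
      using un props[OF P(1)] by (auto simp: permutations_of_set_def dest: in_set_takeD in_set_dropD)
  qed
  have "card (?f ` ?A) = card ?B"
    by (simp add: card_image[OF inj] card_cartesian_product del: One_nat_def)
  then have "?f ` ?A = ?B" using img by (intro card_subset_eq) auto
  with inj show ?thesis unfolding bij_betw_def by blast
qed

text \<open>The expectation \<open>E g(Z)\<close>, kept as a finite sum so that linearity and
  monotonicity carry no integrability conditions.\<close>

definition succ_mean :: "nat \<Rightarrow> (nat \<Rightarrow> real) \<Rightarrow> real" where
  "succ_mean n g = (\<Sum>\<tau>\<in>permutations_of_set {1..n}. g (successions \<tau>)) / fact n"

lemma successions_perm_less:
  assumes "\<tau> \<in> permutations_of_set {1..n}" "n \<ge> 1"
  shows "successions \<tau> < n"
  using successions_less_length[of \<tau>] length_finite_permutations_of_set[OF assms(1)] assms(2)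
  by (cases \<tau>) auto

lemma succ_mean_cong: "n \<ge> 1 \<Longrightarrow> (\<And>z. z < n \<Longrightarrow> f z = g z) \<Longrightarrow> succ_mean n f = succ_mean n g"
  unfolding succ_mean_def by (simp add: successions_perm_less cong: sum.cong)

lemma succ_mean_mono: "n \<ge> 1 \<Longrightarrow> (\<And>z. z < n \<Longrightarrow> f z \<le> g z) \<Longrightarrow> succ_mean n f \<le> succ_mean n g"
  unfolding succ_mean_def by (intro divide_right_mono sum_mono) (auto simp: successions_perm_less)

lemma succ_mean_add: "succ_mean n (\<lambda>z. f z + g z) = succ_mean n f + succ_mean n g"
  by (simp add: succ_mean_def sum.distrib add_divide_distrib)

lemma succ_mean_diff: "succ_mean n (\<lambda>z. f z - g z) = succ_mean n f - succ_mean n g"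
  by (simp add: succ_mean_def sum_subtractf diff_divide_distrib)

lemma succ_mean_cmult: "succ_mean n (\<lambda>z. c * f z) = c * succ_mean n f"
  by (simp add: succ_mean_def sum_distrib_left)

lemma succ_mean_const [simp]: "succ_mean n (\<lambda>z. c) = c"
  by (simp add: succ_mean_def)

lemma succ_mean_sum: "succ_mean n (\<lambda>z. \<Sum>j\<in>A. f j z) = (\<Sum>j\<in>A. succ_mean n (f j))"
  unfolding succ_mean_def by (subst sum.swap) (simp add: sum_divide_distrib)

lemma abs_succ_mean_le: "\<bar>succ_mean n g\<bar> \<le> succ_mean n (\<lambda>z. \<bar>g z\<bar>)"
  by (simp add: succ_mean_def abs_divide divide_right_mono sum_abs)

text \<open>Deleting the maximum of a uniform permutation leaves a uniform permutation together with
  an independent uniform gap. This makes \<open>Z\<close> a Markov chain in \<open>n\<close>, whose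
  transition is expressed here through test functions.\<close>

lemma succ_mean_Suc:
  assumes "n \<ge> 1"
  shows "succ_mean (Suc n) g
    = succ_mean n (\<lambda>z. g (Suc z) + real z * g (z - 1) + (real n - real z) * g z) / real (Suc n)"
proof -
  have "(\<Sum>\<tau>\<in>permutations_of_set {1..Suc n}. g (successions \<tau>))
    = (\<Sum>(\<sigma>, i)\<in>permutations_of_set {1..n} \<times> {..n}. g (successions (take i \<sigma> @ Suc n # drop i \<sigma>)))"
    by (subst sum.reindex_bij_betw[OF bij_betw_insert_max, symmetric]) (simp add: case_prod_unfold)
  also have "\<dots> = (\<Sum>\<sigma>\<in>permutations_of_set {1..n}. \<Sum>i\<le>n. g (successions (take i \<sigma> @ Suc n # drop i \<sigma>)))"
    by (rule sum.cartesian_product[symmetric])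
  also have "\<dots> = (\<Sum>\<sigma>\<in>permutations_of_set {1..n}. g (Suc (successions \<sigma>))
     + real (successions \<sigma>) * g (successions \<sigma> - 1) + (real n - real (successions \<sigma>)) * g (successions \<sigma>))"
    by (rule sum.cong[OF refl]) (rule sum_successions_insert[OF _ assms])
  finally show ?thesis unfolding succ_mean_def by simp
qed

lemma mult_choose_pred:
  "real z * real ((z - 1) choose k) = (real z - real k) * real (z choose k)"
proof (cases z)
  case 0
  then show ?thesis by (cases k) auto
next
  case (Suc y)
  show ?thesis
  proof (cases "k \<le> y")
    case True
    then have "real (Suc y - k) * real (Suc y choose k) = real (Suc y) * real (y choose k)"
      by (metis binomial_absorb_comp diff_Suc_1 of_nat_mult)
    with True Suc show ?thesis by (simp add: of_nat_diff)
  next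
    case False
    then show ?thesis using Suc by (cases "k = Suc y") (auto simp: binomial_eq_0)
  qed
qed

text \<open>Binomial coefficients are the right test functions: by Pascal's rule and
  \<open>mult_choose_pred\<close>, the transition maps order \<open>k\<close> to a combination of
  orders \<open>k\<close> and \<open>k - 1\<close>, so the recursion closes. Beyond the size of the
  permutation the formula would turn negative while the moment is 0, hence the case
  distinction.\<close>

lemma succ_mean_choose_aux:
  "succ_mean (Suc n) (\<lambda>z. real (z choose k))
    = (if k \<le> Suc n then (real (Suc n) - real k) / (real (Suc n) * fact k) else 0)"
proof (induction n arbitrary: k)
  case 0
  have "successions \<tau> = 0" if "\<tau> \<in> permutations_of_set {1..Suc 0}" for \<tau>
    using successions_perm_less[OF that] by simp
  then have "succ_mean (Suc 0) (\<lambda>z. real (z choose k)) = real (0 choose k)"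
    unfolding succ_mean_def by simp
  then show ?case by (cases k) auto
next
  case (Suc n)
  show ?case
  proof (cases k)
    case 0
    then show ?thesis by simp
  next
    case k: (Suc l)
    have "real (Suc z choose k) + real z * real ((z - 1) choose k) + (real (Suc n) - real z) * real (z choose k)
       = (real (Suc (Suc n)) - real k) * real (z choose k) + real (z choose l)" for z
      unfolding mult_choose_pred by (simp add: k algebra_simps)
    then have "succ_mean (Suc (Suc n)) (\<lambda>z. real (z choose k)) =
       ((real (Suc (Suc n)) - real k) * succ_mean (Suc n) (\<lambda>z. real (z choose k))
          + succ_mean (Suc n) (\<lambda>z. real (z choose l))) / real (Suc (Suc n))"
      by (simp only: succ_mean_Suc[of "Suc n"] succ_mean_add succ_mean_cmult le_add2 One_nat_def Suc_le_mono le0)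
    also have "\<dots> = (if k \<le> Suc (Suc n) then (real (Suc (Suc n)) - real k) / (real (Suc (Suc n)) * fact k) else 0)"
    proof -
      consider "k \<le> Suc n" | "k = Suc (Suc n)" | "k > Suc (Suc n)" by linarith
      then show ?thesis
      proof cases
        case 1
        then have l: "l \<le> Suc n" using k by simp
        define N where "N = real (Suc n)"
        have N: "N > 0" "real (Suc (Suc n)) = N + 1" by (simp_all add: N_def)
        have kl: "fact k = (real l + 1) * (fact l :: real)" "real k = real l + 1" using k by auto
        have "((N + 1 - (real l + 1)) * ((N - (real l + 1)) / (N * ((real l + 1) * fact l)))
          + (N - real l) / (N * fact l)) / (N + 1)
           = (N + 1 - (real l + 1)) / ((N + 1) * ((real l + 1) * fact l))"
          using N by (simp add: divide_simps) (simp add: algebra_simps)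
        with 1 l show ?thesis unfolding Suc.IH N(2) kl N_def[symmetric] by simp
      next
        case 2
        then show ?thesis using k by (simp add: Suc.IH)
      next
        case 3
        then show ?thesis using k by (simp add: Suc.IH)
      qed
    qed
    finally show ?thesis .
  qed
qed

lemma succ_mean_choose:
  assumes "n \<ge> 1"
  shows "succ_mean n (\<lambda>z. real (z choose k)) = (if k \<le> n then (real n - real k) / (real n * fact k) else 0)"
  using succ_mean_choose_aux[of "n - 1" k] assms by simp

lemma choose_three_real: "real (z choose 3) = real z * (real z - 1) * (real z - 2) / 6"
  by (simp add: binomial_gbinomial gbinomial_prod_rev numeral_3_eq_3 lessThan_Suc algebra_simps)

text \<open>The first two formulas are exact from \<open>n = 2\<close> on. The third moment is
  \<open>1 - 3 / n\<close> only from \<open>n = 3\<close> on and vanishes at \<open>n = 2\<close>,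
  hence the inequality.\<close>

lemma succ_mean_falling_moments:
  assumes "n \<ge> 2"
  shows "succ_mean n (\<lambda>z. real z) = 1 - 1 / real n"
    and "succ_mean n (\<lambda>z. real z * (real z - 1)) = 1 - 2 / real n"
    and "\<bar>succ_mean n (\<lambda>z. real z * (real z - 1) * (real z - 2)) - 1\<bar> \<le> 3 / real n"
proof -
  have c2: "real (z choose 2) = real z * (real z - 1) / 2" for z
    using choose_two[of z] by (cases z) (auto simp: real_of_nat_div field_simps)
  show "succ_mean n (\<lambda>z. real z) = 1 - 1 / real n"
    using succ_mean_choose[of n 1] assms by (simp add: diff_divide_distrib)
  have "real z * (real z - 1) = 2 * real (z choose 2)" for z by (simp add: c2)
  then show "succ_mean n (\<lambda>z. real z * (real z - 1)) = 1 - 2 / real n"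
    using succ_mean_choose[of n 2] assms by (simp add: succ_mean_cmult field_simps)
  have "real z * (real z - 1) * (real z - 2) = 6 * real (z choose 3)" for z by (simp add: choose_three_real)
  then have eq: "succ_mean n (\<lambda>z. real z * (real z - 1) * (real z - 2)) = 6 * succ_mean n (\<lambda>z. real (z choose 3))"
    by (simp only: succ_mean_cmult)
  have "succ_mean n (\<lambda>z. real (z choose 3)) = (if 3 \<le> n then (1 - 3 / real n) / 6 else 0)"
    using succ_mean_choose[of n 3] assms by (simp add: fact_numeral field_simps)
  with assms show "\<bar>succ_mean n (\<lambda>z. real z * (real z - 1) * (real z - 2)) - 1\<bar> \<le> 3 / real n"
    unfolding eq by (auto simp: field_simps)
qed

lemma bonferroni_2: "real z - real (z choose 2) \<le> of_bool (z \<ge> 1)"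
proof (cases z)
  case (Suc y)
  have "real (Suc (Suc y) choose 2) \<ge> real (Suc y)" for y by (simp add: numeral_2_eq_2)
  then show ?thesis using Suc by (cases y) (auto simp: numeral_2_eq_2)
qed simp

lemma bonferroni_4:
  "real z - real (z choose 2) + real (z choose 3) - real (z choose 4) \<le> of_bool (z \<ge> 1)"
proof (cases z)
  case (Suc y)
  have "real z - real (z choose 2) + real (z choose 3) - real (z choose 4) = 1 - real (y choose 4)"
    using Suc by (simp add: numeral_eq_Suc)
  then show ?thesis using Suc by simp
qed (simp add: binomial_eq_0)

text \<open>In the two-term Bonferroni bound the \<open>1 / n\<close> parts of the moments cancel,
  which leaves exactly \<open>1 / 2\<close> for every \<open>n \<ge> 2\<close>. This suffices for
  termination; the contraction needs strictly more than one half.\<close>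

lemma succ_mean_pos_ge_half:
  assumes "n \<ge> 2"
  shows "succ_mean n (\<lambda>z. of_bool (z \<ge> 1)) \<ge> 1 / 2"
proof -
  have "1 / 2 = succ_mean n (\<lambda>z. real z - real (z choose 2))"
    unfolding succ_mean_diff using assms
    by (simp add: succ_mean_falling_moments succ_mean_choose fact_numeral field_simps)
  also have "\<dots> \<le> succ_mean n (\<lambda>z. of_bool (z \<ge> 1))"
    using assms by (intro succ_mean_mono bonferroni_2) auto
  finally show ?thesis .
qed

text \<open>Two more Bonferroni terms give \<open>1 - 1/2 + 1/6 - 1/24 = 5/8\<close> in the limit;
  the correction \<open>1 / (3 * n)\<close> is small enough from \<open>n = 20\<close> on to leave
  \<open>3 / 5\<close>.\<close>

lemma succ_mean_pos_ge:
  assumes "n \<ge> 20"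
  shows "succ_mean n (\<lambda>z. of_bool (z \<ge> 1)) \<ge> 3 / 5"
proof -
  have "3 / 5 \<le> 5 / 8 - 1 / (3 * real n)" using assms by (simp add: field_simps)
  also have "\<dots> = succ_mean n (\<lambda>z. real z - real (z choose 2) + real (z choose 3) - real (z choose 4))"
    unfolding succ_mean_diff succ_mean_add using assms
    by (simp add: succ_mean_falling_moments succ_mean_choose fact_numeral field_simps)
  also have "\<dots> \<le> succ_mean n (\<lambda>z. of_bool (z \<ge> 1))"
    using assms by (intro succ_mean_mono bonferroni_4) auto
  finally show ?thesis .
qed

text \<open>As \<open>2 ^ z\<close> is the sum of all \<open>z choose k\<close>, its mean is at most
  the sum of all \<open>1 / k!\<close>. This single exponential moment dominates every polynomial
  moment.\<close>

lemma succ_mean_exp_le: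
  assumes "n \<ge> 1"
  shows "succ_mean n (\<lambda>z. 2 ^ z) \<le> exp 1"
proof -
  have "succ_mean n (\<lambda>z. 2 ^ z) = succ_mean n (\<lambda>z. \<Sum>k\<le>n. real (z choose k))"
  proof (rule succ_mean_cong[OF assms])
    fix z assume "z < n"
    have "(2::real) ^ z = (\<Sum>k\<le>z. real (z choose k))"
      by (metis choose_row_sum of_nat_numeral of_nat_power of_nat_sum)
    also have "\<dots> = (\<Sum>k\<le>n. real (z choose k))"
      using \<open>z < n\<close> by (intro sum.mono_neutral_left) (auto simp: binomial_eq_0)
    finally show "(2::real) ^ z = (\<Sum>k\<le>n. real (z choose k))" .
  qed
  also have "\<dots> = (\<Sum>k\<le>n. (real n - real k) / (real n * fact k))"
    unfolding succ_mean_sum using assms by (intro sum.cong) (auto simp: succ_mean_choose)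
  also have "\<dots> \<le> (\<Sum>k\<le>n. inverse (fact k))"
    using assms by (intro sum_mono) (auto simp: field_simps)
  also have "\<dots> \<le> (\<Sum>k. inverse (fact k))"
    using summable_exp[of "1::real"] by (intro sum_le_suminf) auto
  also have "\<dots> = exp 1" by (simp add: exp_def)
  finally show ?thesis .
qed

lemma power_le_exp_bound: "\<exists>C>0. \<forall>z. (1 + real z) ^ k \<le> C * 2 ^ z"
proof -
  have "(\<lambda>z. (1 + real z) ^ k / 2 ^ z) \<longlonglongrightarrow> 0" by real_asymp
  then have "Bseq (\<lambda>z. (1 + real z) ^ k / 2 ^ z)"
    by (intro convergent_imp_Bseq convergentI)
  then obtain C where C: "C > 0" "\<And>z. norm ((1 + real z) ^ k / 2 ^ z) \<le> C"
    by (auto elim: BseqE)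
  have "(1 + real z) ^ k \<le> C * 2 ^ z" for z using C(2)[of z] by (simp add: field_simps)
  with C(1) show ?thesis by blast
qed

lemma succ_mean_power_bounded: "\<exists>C>0. \<forall>n\<ge>1. succ_mean n (\<lambda>z. (1 + real z) ^ k) \<le> C"
proof -
  obtain C where C: "C > 0" "\<And>z. (1 + real z) ^ k \<le> C * 2 ^ z" using power_le_exp_bound by blast
  have "succ_mean n (\<lambda>z. (1 + real z) ^ k) \<le> C * exp 1" if "n \<ge> 1" for n
  proof -
    have "succ_mean n (\<lambda>z. (1 + real z) ^ k) \<le> succ_mean n (\<lambda>z. C * 2 ^ z)"
      using that C(2) by (intro succ_mean_mono)
    also have "\<dots> \<le> C * exp 1"
      unfolding succ_mean_cmult using succ_mean_exp_le[OF that] C(1) by simp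
    finally show ?thesis .
  qed
  then show ?thesis using C(1) by (intro exI[of _ "C * exp 1"]) simp
qed

subsection \<open>Bounds with polynomial dependence on the number of successions\<close>

text \<open>A Landau class for quantities attached to a step from \<open>n\<close> to
  \<open>n - z\<close>: order \<open>w n\<close>, up to a polynomial loss in \<open>z\<close>.
  Functions of \<open>n\<close> alone are treated as constant in \<open>z\<close>, and
  \<open>z < n\<close> keeps \<open>n - z\<close> positive.\<close>

definition poly_bound :: "(nat \<Rightarrow> real) \<Rightarrow> (nat \<Rightarrow> nat \<Rightarrow> real) \<Rightarrow> bool" where
  "poly_bound w f \<longleftrightarrow> (\<exists>K k. \<forall>n\<ge>2. \<forall>z<n. \<bar>f n z\<bar> \<le> K * (1 + real z) ^ k * w n)"

lemma poly_boundI: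
  "(\<And>n z. n \<ge> 2 \<Longrightarrow> z < n \<Longrightarrow> \<bar>f n z\<bar> \<le> K * (1 + real z) ^ k * w n) \<Longrightarrow> poly_bound w f"
  unfolding poly_bound_def by blast

text \<open>The bound is offered for every larger exponent, so that two bounds can be brought to a
  common one.\<close>

lemma poly_boundE:
  assumes "poly_bound w f" "\<And>n. n \<ge> 2 \<Longrightarrow> w n \<ge> 0"
  obtains K k where "K \<ge> 0" "\<And>n z k'. n \<ge> 2 \<Longrightarrow> z < n \<Longrightarrow> k \<le> k' \<Longrightarrow> \<bar>f n z\<bar> \<le> K * (1 + real z) ^ k' * w n"
proof -
  obtain K k where K: "\<And>n z. n \<ge> 2 \<Longrightarrow> z < n \<Longrightarrow> \<bar>f n z\<bar> \<le> K * (1 + real z) ^ k * w n"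
    using assms(1) unfolding poly_bound_def by blast
  have "\<bar>f n z\<bar> \<le> \<bar>K\<bar> * (1 + real z) ^ k' * w n" if "n \<ge> 2" "z < n" "k \<le> k'" for n z k'
  proof -
    have "K * (1 + real z) ^ k * w n \<le> \<bar>K\<bar> * (1 + real z) ^ k' * w n"
      using that assms(2) by (intro mult_right_mono mult_mono power_increasing) auto
    with K[OF that(1,2)] show ?thesis by linarith
  qed
  then show thesis by (intro that[of "\<bar>K\<bar>" k]) auto
qed

lemma poly_bound_cong:
  "poly_bound w f \<Longrightarrow> (\<And>n z. n \<ge> 2 \<Longrightarrow> z < n \<Longrightarrow> f n z = g n z) \<Longrightarrow> poly_bound w g"
  unfolding poly_bound_def by (metis (no_types, lifting))

lemma poly_bound_mono:
  assumes "poly_bound w f" "\<And>n. n \<ge> 2 \<Longrightarrow> w n \<ge> 0" "\<And>n. n \<ge> 2 \<Longrightarrow> w n \<le> C * w' n"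
  shows "poly_bound w' f"
proof -
  obtain K k where K: "K \<ge> 0" "\<And>n z k'. n \<ge> 2 \<Longrightarrow> z < n \<Longrightarrow> k \<le> k' \<Longrightarrow> \<bar>f n z\<bar> \<le> K * (1 + real z) ^ k' * w n"
    using poly_boundE[OF assms(1,2)] by metis
  show ?thesis
  proof (rule poly_boundI)
    fix n z :: nat assume nz: "n \<ge> 2" "z < n"
    have "\<bar>f n z\<bar> \<le> K * (1 + real z) ^ k * w n" using K(2) nz by blast
    also have "\<dots> \<le> K * (1 + real z) ^ k * (C * w' n)"
      using assms(3) nz K(1) by (intro mult_left_mono) auto
    finally show "\<bar>f n z\<bar> \<le> (K * C) * (1 + real z) ^ k * w' n" by (simp add: mult_ac)
  qed
qed

lemma poly_bound_mult:
  assumes "poly_bound u f" "poly_bound v g" "\<And>n. n \<ge> 2 \<Longrightarrow> u n \<ge> 0" "\<And>n. n \<ge> 2 \<Longrightarrow> v n \<ge> 0"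
  shows "poly_bound (\<lambda>n. u n * v n) (\<lambda>n z. f n z * g n z)"
proof -
  obtain K k where K: "K \<ge> 0" "\<And>n z k'. n \<ge> 2 \<Longrightarrow> z < n \<Longrightarrow> k \<le> k' \<Longrightarrow> \<bar>f n z\<bar> \<le> K * (1 + real z) ^ k' * u n"
    using poly_boundE[OF assms(1,3)] by metis
  obtain L l where L: "L \<ge> 0" "\<And>n z k'. n \<ge> 2 \<Longrightarrow> z < n \<Longrightarrow> l \<le> k' \<Longrightarrow> \<bar>g n z\<bar> \<le> L * (1 + real z) ^ k' * v n"
    using poly_boundE[OF assms(2,4)] by metis
  show ?thesis
  proof (rule poly_boundI)
    fix n z :: nat assume nz: "n \<ge> 2" "z < n"
    have "\<bar>f n z * g n z\<bar> \<le> (K * (1 + real z) ^ k * u n) * (L * (1 + real z) ^ l * v n)"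
      unfolding abs_mult using K L nz assms(3,4) by (intro mult_mono) auto
    then show "\<bar>f n z * g n z\<bar> \<le> (K * L) * (1 + real z) ^ (k + l) * (u n * v n)"
      by (simp add: power_add mult_ac)
  qed
qed

lemma poly_bound_add:
  assumes "poly_bound w f" "poly_bound w g" "\<And>n. n \<ge> 2 \<Longrightarrow> w n \<ge> 0"
  shows "poly_bound w (\<lambda>n z. f n z + g n z)"
proof -
  obtain K k where K: "K \<ge> 0" "\<And>n z k'. n \<ge> 2 \<Longrightarrow> z < n \<Longrightarrow> k \<le> k' \<Longrightarrow> \<bar>f n z\<bar> \<le> K * (1 + real z) ^ k' * w n"
    using poly_boundE[OF assms(1,3)] by metis
  obtain L l where L: "L \<ge> 0" "\<And>n z k'. n \<ge> 2 \<Longrightarrow> z < n \<Longrightarrow> l \<le> k' \<Longrightarrow> \<bar>g n z\<bar> \<le> L * (1 + real z) ^ k' * w n"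
    using poly_boundE[OF assms(2,3)] by metis
  show ?thesis
  proof (rule poly_boundI)
    fix n z :: nat assume nz: "n \<ge> 2" "z < n"
    show "\<bar>f n z + g n z\<bar> \<le> (K + L) * (1 + real z) ^ max k l * w n"
      using K(2)[OF nz, of "max k l"] L(2)[OF nz, of "max k l"] by (simp add: algebra_simps)
  qed
qed

lemma poly_bound_cmult: "poly_bound w f \<Longrightarrow> poly_bound w (\<lambda>n z. c * f n z)"
proof -
  assume "poly_bound w f"
  then obtain K k where K: "\<And>n z. n \<ge> 2 \<Longrightarrow> z < n \<Longrightarrow> \<bar>f n z\<bar> \<le> K * (1 + real z) ^ k * w n"
    unfolding poly_bound_def by blast
  have "\<bar>c * f n z\<bar> \<le> (\<bar>c\<bar> * K) * (1 + real z) ^ k * w n" if "n \<ge> 2" "z < n" for n z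
    using mult_left_mono[OF K[OF that] abs_ge_zero[of c]] by (simp add: abs_mult mult_ac)
  then show ?thesis by (rule poly_boundI)
qed

lemma poly_bound_diff:
  assumes "poly_bound w f" "poly_bound w g" "\<And>n. n \<ge> 2 \<Longrightarrow> w n \<ge> 0"
  shows "poly_bound w (\<lambda>n z. f n z - g n z)"
  using poly_bound_add[OF assms(1) poly_bound_cmult[OF assms(2), of "-1"] assms(3)] by simp

lemma poly_bound_sum:
  assumes "\<And>j. j \<in> A \<Longrightarrow> poly_bound w (f j)" "\<And>n. n \<ge> 2 \<Longrightarrow> w n \<ge> 0"
  shows "poly_bound w (\<lambda>n z. \<Sum>j\<in>A. f j n z)"
  using assms(1)
proof (induction A rule: infinite_finite_induct)
  case (insert x F)
  then show ?case using poly_bound_add[OF _ _ assms(2)] by simp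
qed (auto intro!: poly_boundI[where K = 0])

lemma poly_bound_power:
  assumes "poly_bound (\<lambda>n. 1) f"
  shows "poly_bound (\<lambda>n. 1) (\<lambda>n z. f n z ^ i)"
proof (induction i)
  case 0
  then show ?case by (intro poly_boundI[where K = 1 and k = 0]) simp
next
  case (Suc i)
  then show ?case using poly_bound_mult[OF assms Suc] by simp
qed

lemma poly_bound_self: "(\<And>n. n \<ge> 2 \<Longrightarrow> w n \<ge> 0) \<Longrightarrow> poly_bound w (\<lambda>n z. w n)"
  by (intro poly_boundI[where K = 1 and k = 0]) simp

lemma poly_bound_const: "poly_bound (\<lambda>n. 1) (\<lambda>n z. c)"
  by (intro poly_boundI[where K = "\<bar>c\<bar>" and k = 0]) simp

lemma poly_bound_var: "poly_bound (\<lambda>n. 1) (\<lambda>n z. real z)"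
  by (intro poly_boundI[where K = 1 and k = 1]) simp

lemma poly_bound_zero: "poly_bound w (\<lambda>n z. 0)"
  by (intro poly_boundI[where K = 0]) simp

text \<open>The moments of \<open>1 + Z\<close> are bounded uniformly in \<open>n\<close>, so
  averaging turns the polynomial loss into a constant.\<close>

lemma poly_bound_succ_mean:
  assumes "poly_bound w f" "\<And>n. n \<ge> 2 \<Longrightarrow> w n \<ge> 0"
  shows "poly_bound w (\<lambda>n z. succ_mean n (f n))"
proof -
  obtain K k where K: "K \<ge> 0" "\<And>n z k'. n \<ge> 2 \<Longrightarrow> z < n \<Longrightarrow> k \<le> k' \<Longrightarrow> \<bar>f n z\<bar> \<le> K * (1 + real z) ^ k' * w n"
    using poly_boundE[OF assms] by metis
  obtain C where C: "C > 0" "\<And>n. n \<ge> 1 \<Longrightarrow> succ_mean n (\<lambda>z. (1 + real z) ^ k) \<le> C"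
    using succ_mean_power_bounded by blast
  show ?thesis
  proof (rule poly_boundI)
    fix n z :: nat assume n: "n \<ge> 2"
    have "\<bar>succ_mean n (f n)\<bar> \<le> succ_mean n (\<lambda>z. \<bar>f n z\<bar>)" by (rule abs_succ_mean_le)
    also have "\<dots> \<le> succ_mean n (\<lambda>z. (K * w n) * (1 + real z) ^ k)"
      using K(2)[OF n, of _ k] n by (intro succ_mean_mono) (auto simp: mult_ac)
    also have "\<dots> \<le> (K * w n) * C"
      unfolding succ_mean_cmult using C n K(1) assms(2)[OF n] by (intro mult_left_mono) auto
    finally show "\<bar>succ_mean n (f n)\<bar> \<le> (K * C) * (1 + real z) ^ 0 * w n" by (simp add: mult_ac)
  qed
qed

lemma poly_bound_boundedE:
  assumes "poly_bound w (\<lambda>n z. f n)"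
  obtains K where "\<And>n. n \<ge> 2 \<Longrightarrow> \<bar>f n\<bar> \<le> K * w n"
proof -
  obtain K k where "\<And>n z. n \<ge> 2 \<Longrightarrow> z < n \<Longrightarrow> \<bar>f n\<bar> \<le> K * (1 + real z) ^ k * w n"
    using assms unfolding poly_bound_def by blast
  from this[of _ 0] that[of K] show thesis by force
qed

lemma poly_bound_boundedI:
  "(\<And>n. n \<ge> 2 \<Longrightarrow> \<bar>f n\<bar> \<le> K * w n) \<Longrightarrow> poly_bound w (\<lambda>n z. f n)"
  by (intro poly_boundI[where K = K and k = 0]) simp

subsection \<open>Error rates\<close>

text \<open>With \<open>M = m div 2\<close>, the error term of the \<open>m\<close>-th central moment has increments of order
  \<open>err_rate M\<close> and is itself of order \<open>err_rate (Suc M)\<close>; for \<open>M = 0\<close> it vanishes.\<close>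

definition err_rate :: "nat \<Rightarrow> nat \<Rightarrow> real" where
  "err_rate M n = (if M = 0 then 0 else if M = 1 then 1 / real n else real n ^ (M - 2) * (1 + ln (real n)))"

lemma err_rate_0 [simp]: "err_rate 0 n = 0"
  and err_rate_1: "err_rate (Suc 0) n = 1 / real n"
  and err_rate_ge2: "err_rate (Suc (Suc M)) n = real n ^ M * (1 + ln (real n))"
  by (simp_all add: err_rate_def)

lemma err_rate_cases: "M = 0 \<or> M = Suc 0 \<or> (\<exists>M'. M = Suc (Suc M'))"
  by (metis not0_implies_Suc)

lemma err_rate_nonneg: "n \<ge> 1 \<Longrightarrow> err_rate M n \<ge> 0"
  by (simp add: err_rate_def)

lemma err_rate_nonneg2: "n \<ge> 2 \<Longrightarrow> err_rate M n \<ge> 0"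
  by (simp add: err_rate_nonneg)

lemma err_rate_pos:
  assumes "M \<ge> 1" "n \<ge> 1"
  shows "err_rate M n > 0"
proof -
  have "1 + ln (real n) > 0" using assms(2) by (simp add: add_pos_nonneg)
  with assms show ?thesis by (simp add: err_rate_def)
qed

text \<open>Only the rate \<open>1 / n\<close> decreases. There the relative excess is
  \<open>i / (n - i)\<close>, which is at most \<open>2 * i ^ 2 / n\<close> because
  \<open>n \<le> 2 * i * (n - i)\<close>.\<close>

lemma err_rate_slow:
  assumes "i \<ge> 1" "i < n"
  shows "err_rate M (n - i) \<le> err_rate M n * (1 + 2 * real i ^ 2 / real n)"
proof -
  consider "M = 0" | "M = Suc 0" | M' where "M = Suc (Suc M')" using err_rate_cases[of M] by blast
  then show ?thesis
  proof cases
    case 2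
    have ni: "real (n - i) = real n - real i" "real n - real i > 0" "real n > 0" using assms by auto
    \<comment> \<open>Expanded, this says \<open>i * (n - i) \<ge> n - 1\<close>, and
      \<open>2 * (n - 1) \<ge> n\<close>.\<close>
    have "(real i - 1) * (real n - real i - 1) \<ge> 0"
    proof (rule mult_nonneg_nonneg)
      show "real i - 1 \<ge> 0" using assms by simp
      have "real (Suc i) \<le> real n" using assms by (simp only: of_nat_le_iff)
      then show "real n - real i - 1 \<ge> 0" by simp
    qed
    then have "real n \<le> 2 * real i * (real n - real i)"
      using assms by (simp add: algebra_simps)
    then have "real i * real n \<le> real i * (2 * real i * (real n - real i))"
      by (rule mult_left_mono) simp
    then have "1 / (real n - real i) \<le> 1 / real n * (1 + 2 * real i ^ 2 / real n)"
      using ni by (simp add: field_simps power2_eq_square)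
    then show ?thesis using 2 ni by (simp add: err_rate_1)
  next
    case 3
    have "err_rate M (n - i) \<le> err_rate M n"
      unfolding 3 err_rate_ge2 using assms by (intro mult_mono power_mono) auto
    also have "\<dots> \<le> err_rate M n * (1 + 2 * real i ^ 2 / real n)"
      using err_rate_nonneg[of n M] assms by (simp add: mult_le_cancel_left1)
    finally show ?thesis .
  qed simp
qed

lemma err_rate_Suc:
  assumes "n \<ge> 1"
  shows "err_rate M n \<le> err_rate (Suc M) n"
proof -
  consider "M = 0" | "M = Suc 0" | M' where "M = Suc (Suc M')" using err_rate_cases[of M] by blast
  then show ?thesis
  proof cases
    case 2
    have "1 / real n \<le> 1" using assms by simp
    also have "1 \<le> 1 + ln (real n)" using assms by simp
    finally show ?thesis unfolding 2 err_rate_1 err_rate_ge2 by simp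
  next
    case 3
    show ?thesis unfolding 3 err_rate_ge2 using assms
      by (intro mult_right_mono power_increasing) auto
  qed (simp add: err_rate_1)
qed

lemma err_rate_mono: "n \<ge> 1 \<Longrightarrow> L \<le> M \<Longrightarrow> err_rate L n \<le> err_rate M n"
  by (rule lift_Suc_mono_le[of "\<lambda>M. err_rate M n"]) (auto intro: err_rate_Suc)

lemma power_div_le_err_rate:
  assumes "n \<ge> 1"
  shows "real n ^ J / real n \<le> err_rate (Suc J) n"
proof (cases J)
  case (Suc K)
  have "real n ^ K * 1 \<le> real n ^ K * (1 + ln (real n))"
    using assms by (intro mult_left_mono) auto
  with assms show ?thesis by (simp add: Suc err_rate_ge2)
qed (simp add: err_rate_1)

lemma power_le_err_rate: "n \<ge> 1 \<Longrightarrow> real n ^ M \<le> err_rate (Suc (Suc M)) n"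
  using power_div_le_err_rate[of n "Suc M"] by simp

text \<open>The factor \<open>real J\<close> covers \<open>J = 0\<close>, where truncated
  subtraction gives \<open>n ^ (J - 1) = 1\<close> although the derivative of a constant is
  meant.\<close>

lemma power_pred_le_err_rate: "n \<ge> 1 \<Longrightarrow> real J * real n ^ (J - 1) \<le> real J * err_rate (Suc J) n"
  using power_le_err_rate[of n "J - 1"] by (cases J) auto

lemma power_pred_div_le_err_rate:
  "n \<ge> 1 \<Longrightarrow> real J * (real n ^ (J - 1) / real n) \<le> real J * err_rate J n"
  using power_div_le_err_rate[of n "J - 1"] by (cases J) (auto simp del: times_divide_eq_right)

text \<open>Summation raises the order by one. For \<open>M = 1\<close> the comparison of
  \<open>1 / k\<close> with \<open>ln k - ln (k - 1)\<close> produces the logarithm; for larger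
  \<open>M\<close> the rate is nondecreasing and each of the \<open>n - 1\<close> summands is
  bounded by the last.\<close>

lemma sum_err_rate_le:
  assumes "M \<ge> 1" "n \<ge> 2"
  shows "(\<Sum>k=2..n. err_rate M k) \<le> err_rate (Suc M) n"
proof -
  consider "M = Suc 0" | M' where "M = Suc (Suc M')" using err_rate_cases[of M] assms(1) by auto
  then show ?thesis
  proof cases
    case 1
    have "(\<Sum>k=2..n. 1 / real k) \<le> ln (real n)"
      using assms(2)
    proof (induction n rule: dec_induct)
      case base
      have "1 - 1 / (2::real) \<le> ln 2" using ln_one_minus_pos_upper_bound[of "1 / 2 :: real"] by (simp add: ln_div)
      then show ?case by simp
    next
      case (step n)
      have "ln (1 - 1 / real (Suc n)) \<le> - (1 / real (Suc n))"
        using step(1) by (intro ln_one_minus_pos_upper_bound) auto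
      moreover have "1 - 1 / real (Suc n) = real n / real (Suc n)" by (simp add: field_simps)
      ultimately have "1 / real (Suc n) \<le> ln (real (Suc n)) - ln (real n)"
        using step(1) by (simp add: ln_div)
      with step show ?case by simp
    qed
    then show ?thesis unfolding 1 err_rate_1 err_rate_ge2 by simp
  next
    case 2
    have "(\<Sum>k=2..n. err_rate M k) \<le> (\<Sum>k=2..n. real n ^ M' * (1 + ln (real n)))"
      unfolding 2 err_rate_ge2 by (intro sum_mono mult_mono power_mono) auto
    also have "\<dots> = real (n - 1) * (real n ^ M' * (1 + ln (real n)))" using assms(2) by simp
    also have "\<dots> \<le> real n * (real n ^ M' * (1 + ln (real n)))"
      using assms(2) by (intro mult_right_mono) auto
    finally show ?thesis unfolding 2 err_rate_ge2 by (simp add: mult_ac)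
  qed
qed

subsection \<open>Increments of solutions of the one-step recursion\<close>

lemma diff_eq_sum_increments:
  fixes h :: "nat \<Rightarrow> real"
  shows "z \<le> n \<Longrightarrow> h n - h (n - z) = (\<Sum>i<z. h (n - i) - h (n - i - 1))"
proof (induction z)
  case (Suc z)
  then show ?case by simp
qed simp

text \<open>In \<open>h n - h (n - z) = (\<Sum>i<z. h (n - i) - h (n - i - 1))\<close> the increment at \<open>n\<close> has mean weight
  about \<open>1 - 1 / e \<approx> 0.63\<close> and the earlier ones have total mean weight about \<open>1 / e \<approx> 0.37\<close>, so the
  recursion for the increments is a contraction.\<close>

lemma increment_bound:
  fixes h r w :: "nat \<Rightarrow> real"
  assumes eq: "\<And>n. n \<ge> 2 \<Longrightarrow> h n - succ_mean n (\<lambda>z. h (n - z)) = r n"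
    and r: "\<And>n. n \<ge> 2 \<Longrightarrow> \<bar>r n\<bar> \<le> R * w n"
    and w: "\<And>n. n \<ge> 2 \<Longrightarrow> w n > 0"
    and slow: "\<And>n i. 1 \<le> i \<Longrightarrow> i + 2 \<le> n \<Longrightarrow> w (n - i) \<le> w n * (1 + c * real i ^ 2 / real n)"
    and c: "c \<ge> 0"
  shows "\<exists>K\<ge>0. \<forall>n\<ge>2. \<bar>h n - h (n - 1)\<bar> \<le> K * w n"
proof -
  define d where "d n = h n - h (n - 1)" for n
  obtain C3 where C3: "C3 > 0" "\<And>n. n \<ge> 1 \<Longrightarrow> succ_mean n (\<lambda>z. (1 + real z) ^ 3) \<le> C3"
    using succ_mean_power_bounded by blast
  \<comment> \<open>From 20 on \<open>p \<ge> 3 / 5\<close> is available; beyond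
    \<open>10 * c * C3\<close> the correction coming from \<open>slow\<close> is at most
    \<open>1 / 10\<close>.\<close>
  define N where "N = max 20 (nat \<lceil>10 * c * C3\<rceil>)"
  \<comment> \<open>The sum settles all \<open>n \<le> N\<close>; the other summand makes the
    inhomogeneity at most \<open>K / 10 * w n\<close>.\<close>
  define K where "K = 10 * \<bar>R\<bar> + (\<Sum>k=2..N. \<bar>d k\<bar> / w k)"
  have sum_nn: "(\<Sum>k=2..N. \<bar>d k\<bar> / w k) \<ge> 0"
    using w by (intro sum_nonneg divide_nonneg_nonneg) (auto intro: less_imp_le)
  then have K: "K \<ge> 0" "10 * \<bar>R\<bar> \<le> K" by (auto simp: K_def)
  have "\<bar>d n\<bar> \<le> K * w n" if "n \<ge> 2" for n
    using that
  proof (induction n rule: less_induct)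
    case (less n)
    note n = \<open>n \<ge> 2\<close>
    note wn = w[OF n]
    show ?case
    proof (cases "n \<le> N")
      case True
      have "\<bar>d n\<bar> / w n \<le> (\<Sum>k=2..N. \<bar>d k\<bar> / w k)"
        using True n w by (intro member_le_sum divide_nonneg_nonneg) (auto intro: less_imp_le)
      also have "\<dots> \<le> K" by (simp add: K_def)
      finally show ?thesis using wn by (simp add: field_simps)
    next
      case False
      then have big: "n \<ge> 20" "10 * c * C3 \<le> real n" unfolding N_def by linarith+
      define p where "p = succ_mean n (\<lambda>z. of_bool (z \<ge> 1))"
      have p: "p \<ge> 3 / 5" unfolding p_def by (rule succ_mean_pos_ge[OF big(1)])
      define g where "g z = (\<Sum>i\<in>{1..<z}. d (n - i))" for z
      have split: "h n - h (n - z) = d n * of_bool (z \<ge> 1) + g z" if "z < n" for z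
      proof (cases z)
        case (Suc y)
        have "{..<z} = insert 0 {1..<z}" using Suc by auto
        with that show ?thesis
          unfolding g_def by (subst diff_eq_sum_increments) (auto simp: d_def Suc)
      qed (simp add: g_def)
      \<comment> \<open>The number of earlier increments is \<open>z - of_bool (z \<ge> 1)\<close>,
        whose mean is \<open>1 - 1 / n - p\<close>.\<close>
      have gb: "\<bar>g z\<bar> \<le> (K * w n) * (real z - of_bool (z \<ge> 1) + c / real n * (1 + real z) ^ 3)" if "z < n" for z
      proof -
        have "\<bar>g z\<bar> \<le> (\<Sum>i\<in>{1..<z}. \<bar>d (n - i)\<bar>)" unfolding g_def by (rule sum_abs)
        also have "\<dots> \<le> (\<Sum>i\<in>{1..<z}. (K * w n) * (1 + c / real n * (1 + real z) ^ 2))"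
        proof (rule sum_mono)
          fix i assume i: "i \<in> {1..<z}"
          have "\<bar>d (n - i)\<bar> \<le> K * w (n - i)" using i that by (intro less.IH) auto
          also have "\<dots> \<le> K * (w n * (1 + c * real i ^ 2 / real n))"
            using i that K by (intro mult_left_mono slow) auto
          also have "\<dots> \<le> K * (w n * (1 + c * (1 + real z) ^ 2 / real n))"
            using i that K wn c by (intro mult_left_mono add_left_mono divide_right_mono power_mono) auto
          finally show "\<bar>d (n - i)\<bar> \<le> (K * w n) * (1 + c / real n * (1 + real z) ^ 2)" by (simp add: mult_ac)
        qed
        also have "\<dots> = (K * w n) * ((real z - of_bool (z \<ge> 1)) * (1 + c / real n * (1 + real z) ^ 2))"
          by (cases z) (auto simp: mult_ac)
        also have "\<dots> \<le> (K * w n) * (real z - of_bool (z \<ge> 1) + c / real n * (1 + real z) ^ 3)"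
        proof (rule mult_left_mono)
          have "(real z - of_bool (z \<ge> 1)) * (c / real n * (1 + real z) ^ 2)
            \<le> (1 + real z) * (c / real n * (1 + real z) ^ 2)"
            using c by (intro mult_right_mono) auto
          moreover have "(1 + real z) * (c / real n * (1 + real z) ^ 2) = c / real n * (1 + real z) ^ 3"
            by (simp add: power3_eq_cube power2_eq_square)
          ultimately show "(real z - of_bool (z \<ge> 1)) * (1 + c / real n * (1 + real z) ^ 2)
            \<le> real z - of_bool (z \<ge> 1) + c / real n * (1 + real z) ^ 3"
            by (simp only: distrib_left mult_1_right)
        qed (use K wn in simp)
        finally show ?thesis .
      qed
      have "succ_mean n (\<lambda>z. h n - h (n - z)) = r n"
        unfolding succ_mean_diff using eq[OF n] by simp
      moreover have "succ_mean n (\<lambda>z. h n - h (n - z)) = succ_mean n (\<lambda>z. d n * of_bool (z \<ge> 1) + g z)"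
        using n split by (intro succ_mean_cong) auto
      ultimately have rn: "r n = d n * p + succ_mean n g"
        by (simp add: succ_mean_add succ_mean_cmult p_def)
      have "\<bar>succ_mean n g\<bar> \<le> succ_mean n (\<lambda>z. \<bar>g z\<bar>)" by (rule abs_succ_mean_le)
      also have "\<dots> \<le> succ_mean n (\<lambda>z. (K * w n) * (real z - of_bool (z \<ge> 1) + c / real n * (1 + real z) ^ 3))"
        using n gb by (intro succ_mean_mono) auto
      also have "\<dots> = (K * w n) * (1 - 1 / real n - p + c / real n * succ_mean n (\<lambda>z. (1 + real z) ^ 3))"
        using succ_mean_falling_moments(1)[OF n]
        by (simp only: succ_mean_cmult succ_mean_add succ_mean_diff p_def)
      also have "\<dots> \<le> (K * w n) * (1 / 2)"
      proof (rule mult_left_mono)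
        have "c / real n * succ_mean n (\<lambda>z. (1 + real z) ^ 3) \<le> c / real n * C3"
          using C3(2)[of n] c n by (intro mult_left_mono) auto
        also have "\<dots> \<le> 1 / 10" using big by (simp add: field_simps)
        finally have "c / real n * succ_mean n (\<lambda>z. (1 + real z) ^ 3) \<le> 1 / 10" .
        moreover have "1 / real n \<ge> 0" by simp
        ultimately show "1 - 1 / real n - p + c / real n * succ_mean n (\<lambda>z. (1 + real z) ^ 3) \<le> 1 / 2"
          using p by linarith
      qed (use K wn in simp)
      finally have g_le: "\<bar>succ_mean n g\<bar> \<le> K * w n * (1 / 2)" .
      \<comment> \<open>The constants are balanced: \<open>1 / 10 + 1 / 2 = 3 / 5\<close>, so the
        induction reproduces the same \<open>K\<close>.\<close>
      have "3 / 5 * \<bar>d n\<bar> \<le> p * \<bar>d n\<bar>" using p by (rule mult_right_mono) simp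
      also have "\<dots> = \<bar>r n - succ_mean n g\<bar>" using rn p by (simp add: abs_mult)
      also have "\<dots> \<le> \<bar>R\<bar> * w n + K * w n * (1 / 2)"
      proof -
        have "R * w n \<le> \<bar>R\<bar> * w n" using wn by (intro mult_right_mono) auto
        then show ?thesis using r[OF n] g_le by linarith
      qed
      also have "\<dots> \<le> K / 10 * w n + K * w n * (1 / 2)"
        using K wn by (intro add_right_mono mult_right_mono) auto
      finally show ?thesis by simp
    qed
  qed
  with K(1) show ?thesis unfolding d_def by blast
qed

text \<open>The invariant of the induction on \<open>m\<close>: how much an error term varies over
  one step, and how large it is.\<close>

definition small_error :: "nat \<Rightarrow> (nat \<Rightarrow> real) \<Rightarrow> bool" where
  "small_error M h \<longleftrightarrow> poly_bound (err_rate M) (\<lambda>n z. h (n - z) - h n)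
     \<and> poly_bound (err_rate (Suc M)) (\<lambda>n z. h n)"

text \<open>Summing \<open>z\<close> increments bounds the variation, summing all of them down to 1
  the size. The starting value \<open>h 1\<close> is absorbed since \<open>err_rate (Suc M)\<close>
  is at least 1 for \<open>M \<ge> 1\<close>.\<close>

lemma small_error_of_increments:
  assumes d: "\<And>n. n \<ge> 2 \<Longrightarrow> \<bar>h n - h (n - 1)\<bar> \<le> K * err_rate M n" and K: "K \<ge> 0" and M: "M \<ge> 1"
  shows "small_error M h"
  unfolding small_error_def
proof
  show "poly_bound (err_rate M) (\<lambda>n z. h (n - z) - h n)"
  proof (rule poly_boundI)
    fix n z :: nat assume n: "n \<ge> 2" and z: "z < n"
    have e: "err_rate M n \<ge> 0" using n by (intro err_rate_nonneg) simp
    have "\<bar>h (n - z) - h n\<bar> = \<bar>\<Sum>i<z. h (n - i) - h (n - i - 1)\<bar>"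
      using z by (subst diff_eq_sum_increments[symmetric]) auto
    also have "\<dots> \<le> (\<Sum>i<z. \<bar>h (n - i) - h (n - i - 1)\<bar>)" by (rule sum_abs)
    also have "\<dots> \<le> (\<Sum>i<z. K * err_rate M n * (3 * (1 + real z) ^ 2))"
    proof (rule sum_mono)
      fix i assume i: "i \<in> {..<z}"
      have "\<bar>h (n - i) - h (n - i - 1)\<bar> \<le> K * err_rate M (n - i)" using i z by (intro d) auto
      also have "err_rate M (n - i) \<le> err_rate M n * (1 + 2 * real i ^ 2 / real n)"
        using i z err_rate_slow[of i n M] by (cases "i = 0") auto
      also have "\<dots> \<le> err_rate M n * (3 * (1 + real z) ^ 2)"
      proof (rule mult_left_mono[OF _ e])
        have "2 * real i ^ 2 / real n \<le> 2 * real i ^ 2"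
          using n by (simp add: divide_le_eq mult_le_cancel_left1)
        also have "real i ^ 2 \<le> (1 + real z) ^ 2" using i by (intro power_mono) auto
        moreover have "1 \<le> (1 + real z) ^ 2" by simp
        ultimately show "1 + 2 * real i ^ 2 / real n \<le> 3 * (1 + real z) ^ 2" by linarith
      qed
      finally show "\<bar>h (n - i) - h (n - i - 1)\<bar> \<le> K * err_rate M n * (3 * (1 + real z) ^ 2)"
        using K by (simp add: mult_left_mono mult.assoc)
    qed
    also have "\<dots> = real z * (K * err_rate M n * (3 * (1 + real z) ^ 2))" by simp
    also have "\<dots> \<le> (1 + real z) * (K * err_rate M n * (3 * (1 + real z) ^ 2))"
      using K e by (intro mult_right_mono) auto
    also have "\<dots> = (3 * K) * (1 + real z) ^ 3 * err_rate M n"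
      by (simp only: power3_eq_cube power2_eq_square mult_ac)
    finally show "\<bar>h (n - z) - h n\<bar> \<le> (3 * K) * (1 + real z) ^ 3 * err_rate M n" .
  qed
  show "poly_bound (err_rate (Suc M)) (\<lambda>n z. h n)"
  proof (rule poly_bound_boundedI)
    fix n :: nat assume n: "n \<ge> 2"
    have "h n - h (n - (n - 1)) = (\<Sum>i<n-1. h (n - i) - h (n - i - 1))"
      by (rule diff_eq_sum_increments) simp
    then have "\<bar>h n\<bar> \<le> \<bar>h 1\<bar> + \<bar>\<Sum>i<n-1. h (n - i) - h (n - i - 1)\<bar>" using n by simp
    also have "\<bar>\<Sum>i<n-1. h (n - i) - h (n - i - 1)\<bar> \<le> (\<Sum>i<n-1. K * err_rate M (n - i))"
      by (rule order.trans[OF sum_abs]) (intro sum_mono d, auto)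
    also have "\<dots> = (\<Sum>k=2..n. K * err_rate M k)"
      by (rule sum.reindex_bij_witness[of _ "\<lambda>k. n - k" "\<lambda>i. n - i"]) auto
    also have "\<dots> \<le> K * err_rate (Suc M) n"
      using sum_err_rate_le[OF M n] K by (simp add: sum_distrib_left[symmetric] mult_left_mono)
    finally have "\<bar>h n\<bar> \<le> \<bar>h 1\<bar> + K * err_rate (Suc M) n" by simp
    moreover have "\<bar>h 1\<bar> * 1 \<le> \<bar>h 1\<bar> * err_rate (Suc M) n"
    proof (rule mult_left_mono)
      have "1 = real n ^ 0" by simp
      also have "\<dots> \<le> err_rate (Suc (Suc 0)) n" using n by (intro power_le_err_rate) simp
      also have "\<dots> \<le> err_rate (Suc M) n" using n M by (intro err_rate_mono) auto
      finally show "1 \<le> err_rate (Suc M) n" .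
    qed simp
    ultimately show "\<bar>h n\<bar> \<le> (\<bar>h 1\<bar> + K) * err_rate (Suc M) n" by (simp add: algebra_simps)
  qed
qed

lemma error_increments:
  fixes h r :: "nat \<Rightarrow> real"
  assumes eq: "\<And>n. n \<ge> 2 \<Longrightarrow> h n - succ_mean n (\<lambda>z. h (n - z)) = r n"
    and r: "poly_bound (err_rate M) (\<lambda>n z. r n)" and M: "M \<ge> 1"
  obtains K where "K \<ge> 0" "\<And>n. n \<ge> 2 \<Longrightarrow> \<bar>h n - h (n - 1)\<bar> \<le> K * err_rate M n"
proof -
  obtain R where R: "\<And>n. n \<ge> 2 \<Longrightarrow> \<bar>r n\<bar> \<le> R * err_rate M n"
    using poly_bound_boundedE[OF r] by blast
  have "\<exists>K\<ge>0. \<forall>n\<ge>2. \<bar>h n - h (n - 1)\<bar> \<le> K * err_rate M n"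
  proof (rule increment_bound[OF eq R])
    show "\<And>n. n \<ge> 2 \<Longrightarrow> err_rate M n > 0" using M by (intro err_rate_pos) auto
    show "\<And>n i. 1 \<le> i \<Longrightarrow> i + 2 \<le> n \<Longrightarrow> err_rate M (n - i) \<le> err_rate M n * (1 + 2 * real i ^ 2 / real n)"
      by (intro err_rate_slow) auto
  qed auto
  with that show thesis by blast
qed

subsection \<open>The recursion for the central moments\<close>

text \<open>At \<open>m = 0\<close> truncated subtraction yields
  \<open>double_factorial 0 = 1\<close>, and at \<open>m = 1\<close> the value is 0; both agree with
  the exact moments, which start the induction.\<close>

definition lead :: "nat \<Rightarrow> real" where
  "lead m = (if even m then real (double_factorial (m - 1))
     else 2 / 3 * real (m div 2) * real (double_factorial m))"

lemma main_term_lead: "main_term m n = lead m * real n ^ (m div 2)"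
proof (cases "even m")
  case False
  then have "2 * (m div 2) + 1 = m" by (simp add: odd_two_times_div_two_succ)
  with False show ?thesis by (simp add: main_term_def lead_def Let_def)
qed (simp add: main_term_def lead_def Let_def)

lemma double_factorial_odd_Suc:
  "double_factorial (2 * Suc M - 1) = (2 * M + 1) * double_factorial (2 * M - 1)"
  by (cases M) auto

lemma lead_even: "lead (2 * M) = real (double_factorial (2 * M - 1))"
  and lead_odd: "lead (2 * M + 1) = 2 / 3 * real M * real (double_factorial (2 * M + 1))"
  by (simp_all add: lead_def)

text \<open>Comparison of coefficients at \<open>n ^ M\<close> for the order
  \<open>2 * Suc M\<close>: the term \<open>j = m - 2\<close>, with \<open>E (1 - Z) ^ 2\<close>
  close to 1, must balance the derivative of the leading power.\<close>

lemma lead_even_recursion: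
  "real ((2 * Suc M) choose 2) * lead (2 * M) = real (Suc M) * lead (2 * Suc M)"
proof -
  have "real ((2 * Suc M) choose 2) = real (Suc M) * real (2 * M + 1)"
    by (simp add: choose_two algebra_simps)
  moreover have "lead (2 * Suc M) = real (2 * M + 1) * lead (2 * M)"
    unfolding lead_def double_factorial_odd_Suc by (simp add: algebra_simps)
  ultimately show ?thesis by (simp only: mult.assoc)
qed

text \<open>For odd order, \<open>j = m - 1\<close>, \<open>m - 2\<close> and \<open>m - 3\<close>
  all contribute to the coefficient of \<open>n ^ Suc M / n\<close>; the minus sign comes from the
  third moment \<open>-1\<close> of \<open>1 - Z\<close>. Starting from \<open>lead 1 = 0\<close>,
  this determines the odd coefficients and so the factor \<open>2 / 3\<close>.\<close>

lemma lead_odd_recursion: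
  "real (2 * Suc M + 1) * lead (2 * Suc M) * real (Suc M)
     + real ((2 * Suc M + 1) choose 2) * lead (2 * M + 1) - real ((2 * Suc M + 1) choose 3) * lead (2 * M)
   = real (Suc M) * lead (2 * Suc M + 1)"
proof -
  define F where "F = real (double_factorial (2 * M - 1))"
  have F1: "real (double_factorial (2 * M + 1)) = real (2 * M + 1) * F"
    using double_factorial_odd_Suc[of M] by (simp add: F_def algebra_simps)
  have F2: "real (double_factorial (2 * M + 3)) = real (2 * M + 3) * (real (2 * M + 1) * F)"
    using F1 by (simp add: numeral_eq_Suc) (simp add: algebra_simps)
  have c2: "real ((2 * Suc M + 1) choose 2) = real (2 * M + 3) * real (M + 1)"
    by (simp add: choose_two algebra_simps)
  have c3: "real ((2 * Suc M + 1) choose 3) = real (2 * M + 3) * real (M + 1) * real (2 * M + 1) / 3"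
    unfolding choose_three_real by (simp add: algebra_simps)
  have l: "lead (2 * Suc M) = real (2 * M + 1) * F" "lead (2 * M) = F"
    "lead (2 * M + 1) = 2 / 3 * real M * (real (2 * M + 1) * F)"
    "lead (2 * Suc M + 1) = 2 / 3 * real (M + 1) * (real (2 * M + 3) * (real (2 * M + 1) * F))"
  proof -
    show "lead (2 * Suc M) = real (2 * M + 1) * F" "lead (2 * M) = F"
      unfolding lead_even double_factorial_odd_Suc F_def by (simp_all add: algebra_simps)
    show "lead (2 * M + 1) = 2 / 3 * real M * (real (2 * M + 1) * F)"
      unfolding lead_odd F1 ..
    have "2 * Suc M + 1 = 2 * M + 3" by simp
    then show "lead (2 * Suc M + 1) = 2 / 3 * real (M + 1) * (real (2 * M + 3) * (real (2 * M + 1) * F))"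
      using lead_odd[of "Suc M"] F2 by (simp only: Suc_eq_plus1)
  qed
  show ?thesis unfolding l c2 c3 by (simp add: field_simps)
qed

lemma power_step_expansion:
  assumes "z < n"
  shows "\<bar>real (n - z) ^ J - real n ^ J + real J * real z * real n ^ (J - 1)\<bar>
    \<le> real J ^ 2 * real z ^ 2 * err_rate J n"
proof -
  consider "J = 0" | "J = Suc 0" | M where "J = Suc (Suc M)" using err_rate_cases[of J] by blast
  then show ?thesis
  proof cases
    case 2
    with assms show ?thesis by (simp add: of_nat_diff err_rate_nonneg)
  next
    case 3
    define a where "a = real (n - z)"
    have a: "a \<ge> 0" "a \<le> real n" "real z = real n - a" using assms by (auto simp: a_def of_nat_diff)
    \<comment> \<open>Raising the exponent multiplies the Taylor remainder by \<open>a\<close> and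
      adds \<open>(K + 2) * z ^ 2 * n ^ (K + 1)\<close>; the constants fit as
      \<open>(K + 2) ^ 2 + (K + 2) \<le> (K + 3) ^ 2\<close>.\<close>
    have *: "\<bar>a ^ Suc (Suc K) - real n ^ Suc (Suc K) + real (Suc (Suc K)) * real z * real n ^ Suc K\<bar>
       \<le> real (Suc (Suc K)) ^ 2 * real z ^ 2 * real n ^ K" for K
    proof (induction K)
      case 0
      have "a ^ Suc (Suc 0) - real n ^ Suc (Suc 0) + real (Suc (Suc 0)) * real z * real n ^ Suc 0 = real z ^ 2"
        unfolding a(3) by (simp add: power2_eq_square algebra_simps)
      then show ?case by simp
    next
      case (Suc K)
      define R where "R = a ^ Suc (Suc K) - real n ^ Suc (Suc K) + real (Suc (Suc K)) * real z * real n ^ Suc K"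
      have "a ^ Suc (Suc (Suc K)) - real n ^ Suc (Suc (Suc K))
        + real (Suc (Suc (Suc K))) * real z * real n ^ Suc (Suc K)
         = a * R + real (Suc (Suc K)) * real z ^ 2 * real n ^ Suc K"
        unfolding R_def a(3) by (simp add: power2_eq_square algebra_simps)
      also have "\<bar>\<dots>\<bar>
        \<le> real n * (real (Suc (Suc K)) ^ 2 * real z ^ 2 * real n ^ K)
          + real (Suc (Suc K)) * real z ^ 2 * real n ^ Suc K"
        using Suc a by (intro order.trans[OF abs_triangle_ineq] add_mono) (auto simp: abs_mult R_def intro!: mult_mono)
      also have "\<dots> = (real (Suc (Suc K)) ^ 2 + real (Suc (Suc K))) * real z ^ 2 * real n ^ Suc K"
        by (simp add: algebra_simps)
      also have "\<dots> \<le> real (Suc (Suc (Suc K))) ^ 2 * real z ^ 2 * real n ^ Suc K"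
        by (intro mult_right_mono) (auto simp: power2_eq_square algebra_simps)
      finally show ?case .
    qed
    have "\<bar>real (n - z) ^ J - real n ^ J + real J * real z * real n ^ (J - 1)\<bar> \<le> real J ^ 2 * real z ^ 2 * real n ^ M"
      using *[of M] by (simp add: 3 a_def)
    also have "\<dots> \<le> real J ^ 2 * real z ^ 2 * err_rate J n"
      unfolding 3 using assms by (intro mult_left_mono power_le_err_rate) auto
    finally show ?thesis .
  qed simp
qed

lemma poly_bound_power_step:
  "poly_bound (err_rate J) (\<lambda>n z. real (n - z) ^ J - real n ^ J + real J * real z * real n ^ (J - 1))"
proof (rule poly_boundI)
  fix n z :: nat assume nz: "n \<ge> 2" "z < n"
  have "\<bar>real (n - z) ^ J - real n ^ J + real J * real z * real n ^ (J - 1)\<bar> \<le> real J ^ 2 * real z ^ 2 * err_rate J n"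
    by (rule power_step_expansion[OF nz(2)])
  also have "\<dots> \<le> real J ^ 2 * (1 + real z) ^ 2 * err_rate J n"
    using nz by (intro mult_right_mono mult_left_mono power_mono) (auto simp: err_rate_nonneg)
  finally show "\<bar>real (n - z) ^ J - real n ^ J + real J * real z * real n ^ (J - 1)\<bar>
    \<le> real J ^ 2 * (1 + real z) ^ 2 * err_rate J n" .
qed

lemma poly_bound_err_rate_mono: "poly_bound (err_rate L) f \<Longrightarrow> L \<le> M \<Longrightarrow> poly_bound (err_rate M) f"
  by (rule poly_bound_mono[where C = 1]) (auto simp: err_rate_nonneg2 intro: err_rate_mono)

lemma poly_bound_size_power: "poly_bound (err_rate (Suc (Suc J))) (\<lambda>n z. real n ^ J)"
  by (rule poly_bound_boundedI[where K = 1]) (use power_le_err_rate in auto)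

lemma poly_bound_power_pred: "poly_bound (err_rate (Suc J)) (\<lambda>n z. real J * real n ^ (J - 1))"
  by (rule poly_bound_boundedI[where K = "real J"]) (use power_pred_le_err_rate in auto)

lemma poly_bound_power_pred_div: "poly_bound (err_rate J) (\<lambda>n z. real J * real n ^ (J - 1) / real n)"
  by (rule poly_bound_boundedI[where K = "real J"]) (use power_pred_div_le_err_rate in auto)

lemma poly_bound_mult1:
  assumes "poly_bound (err_rate M) f" "poly_bound (\<lambda>n. 1) g"
  shows "poly_bound (err_rate M) (\<lambda>n z. f n z * g n z)"
  using poly_bound_mult[OF assms] by (simp add: err_rate_nonneg2)

text \<open>All that the asymptotics require from the process. The last assumption is the binomial
  expansion of the recentred variable after the first step.\<close>

locale moment_recursion =
  fixes \<nu> :: "nat \<Rightarrow> real" and C :: "nat \<Rightarrow> nat \<Rightarrow> real"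
  assumes mean_rec: "n \<ge> 2 \<Longrightarrow> \<nu> n = 1 + succ_mean n (\<lambda>z. \<nu> (n - z))"
    and C_0: "n \<ge> 1 \<Longrightarrow> C 0 n = 1"
    and C_1: "n \<ge> 1 \<Longrightarrow> C (Suc 0) n = 0"
    and C_rec: "n \<ge> 2 \<Longrightarrow> C m n =
      succ_mean n (\<lambda>z. \<Sum>j\<le>m. real (m choose j) * C j (n - z) * (1 + \<nu> (n - z) - \<nu> n) ^ (m - j))"
begin

text \<open>For the process this is the conditional mean of \<open>X n - \<mu> n\<close>, given
  \<open>z\<close> successions in the first step.\<close>

definition D :: "nat \<Rightarrow> nat \<Rightarrow> real" where
  "D n z = 1 + \<nu> (n - z) - \<nu> n"

lemma mean_D: "n \<ge> 2 \<Longrightarrow> succ_mean n (D n) = 0"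
  using mean_rec[of n] unfolding D_def by (simp add: succ_mean_add succ_mean_diff)

text \<open>The identity almost solves the recursion of the mean: as
  \<open>E (n - Z) = n - 1 + 1 / n\<close>, the difference \<open>\<nu> n - n\<close> solves it with
  inhomogeneity \<open>1 / n\<close> only, and its increments inherit this rate.\<close>

lemma D_approx: "poly_bound (err_rate (Suc 0)) (\<lambda>n z. D n z - (1 - real z))"
proof -
  have eq: "(\<nu> n - real n) - succ_mean n (\<lambda>z. \<nu> (n - z) - real (n - z)) = 1 / real n" if "n \<ge> 2" for n
  proof -
    have "succ_mean n (\<lambda>z. real (n - z)) = succ_mean n (\<lambda>z. real n - real z)"
      using that by (intro succ_mean_cong) (auto simp: of_nat_diff)
    also have "\<dots> = real n - (1 - 1 / real n)"
      using succ_mean_falling_moments(1)[OF that] by (simp add: succ_mean_diff)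
    finally show ?thesis using mean_rec[OF that] by (simp add: succ_mean_diff)
  qed
  obtain K where "K \<ge> 0" "\<And>n. n \<ge> 2 \<Longrightarrow> \<bar>(\<nu> n - real n) - (\<nu> (n - 1) - real (n - 1))\<bar> \<le> K * err_rate (Suc 0) n"
    by (rule error_increments[OF eq, of "Suc 0"])
      (auto intro!: poly_bound_boundedI[where K = 1] simp: err_rate_1)
  then have "small_error (Suc 0) (\<lambda>n. \<nu> n - real n)"
    by (intro small_error_of_increments[where K = K]) auto
  then have "poly_bound (err_rate (Suc 0)) (\<lambda>n z. (\<nu> (n - z) - real (n - z)) - (\<nu> n - real n))"
    unfolding small_error_def by blast
  then show ?thesis
    by (rule poly_bound_cong) (auto simp: D_def of_nat_diff)
qed

lemma poly_bound_D: "poly_bound (\<lambda>n. 1) D"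
proof -
  have "poly_bound (\<lambda>n. 1) (\<lambda>n z. D n z - (1 - real z))"
    by (rule poly_bound_mono[where C = 1, OF D_approx]) (auto simp: err_rate_1)
  moreover have "poly_bound (\<lambda>n. 1) (\<lambda>n z. 1 - real z)"
    by (intro poly_bound_diff poly_bound_const poly_bound_var) simp
  ultimately have "poly_bound (\<lambda>n. 1) (\<lambda>n z. (D n z - (1 - real z)) + (1 - real z))"
    by (rule poly_bound_add) simp
  then show ?thesis by simp
qed

lemma poly_bound_1_minus: "poly_bound (\<lambda>n. 1) (\<lambda>n z. (1 - real z) ^ i)"
  by (intro poly_bound_diff poly_bound_const poly_bound_var poly_bound_power) simp

lemma D_power_approx: "poly_bound (err_rate (Suc 0)) (\<lambda>n z. D n z ^ i - (1 - real z) ^ i)"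
proof (induction i)
  case 0
  then show ?case by (simp add: poly_bound_zero)
next
  case (Suc i)
  have "poly_bound (err_rate (Suc 0)) (\<lambda>n z. (D n z ^ i - (1 - real z) ^ i) * D n z)"
    by (intro poly_bound_mult1 Suc poly_bound_D)
  moreover have "poly_bound (err_rate (Suc 0)) (\<lambda>n z. (D n z - (1 - real z)) * (1 - real z) ^ i)"
    by (intro poly_bound_mult1 D_approx poly_bound_1_minus)
  ultimately have "poly_bound (err_rate (Suc 0))
     (\<lambda>n z. (D n z ^ i - (1 - real z) ^ i) * D n z + (D n z - (1 - real z)) * (1 - real z) ^ i)"
    by (rule poly_bound_add) (rule err_rate_nonneg2)
  then show ?case by (rule poly_bound_cong) (simp add: algebra_simps)
qed

section \<open>Estimates for the single terms of the moment recursion\<close>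

definition err :: "nat \<Rightarrow> nat \<Rightarrow> real" where
  "err m n = C m n - main_term m n"

lemma C_eq: "C m n = lead m * real n ^ (m div 2) + err m n"
  by (simp add: err_def main_term_lead)

lemma C_increment:
  assumes "small_error (j div 2) (err j)"
  shows "poly_bound (err_rate (j div 2))
    (\<lambda>n z. C j (n - z) - C j n + lead j * real z * (real (j div 2) * real n ^ (j div 2 - 1)))"
proof -
  have "poly_bound (err_rate (j div 2)) (\<lambda>n z. lead j * (real (n - z) ^ (j div 2) - real n ^ (j div 2)
        + real (j div 2) * real z * real n ^ (j div 2 - 1)) + (err j (n - z) - err j n))"
    using assms unfolding small_error_def
    by (intro poly_bound_add poly_bound_cmult poly_bound_power_step) (auto simp: err_rate_nonneg2)
  then show ?thesis by (rule poly_bound_cong) (simp add: C_eq algebra_simps)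
qed

lemma C_increment_coarse:
  assumes "small_error (j div 2) (err j)"
  shows "poly_bound (err_rate (Suc (j div 2))) (\<lambda>n z. C j (n - z) - C j n)"
proof -
  have "poly_bound (err_rate (Suc (j div 2)))
    (\<lambda>n z. C j (n - z) - C j n + lead j * real z * (real (j div 2) * real n ^ (j div 2 - 1)))"
    by (rule poly_bound_err_rate_mono[OF C_increment[OF assms]]) simp
  moreover have "poly_bound (err_rate (Suc (j div 2)))
    (\<lambda>n z. lead j * ((real (j div 2) * real n ^ (j div 2 - 1)) * real z))"
    by (intro poly_bound_cmult poly_bound_mult1 poly_bound_power_pred poly_bound_var)
  ultimately have "poly_bound (err_rate (Suc (j div 2)))
    (\<lambda>n z. (C j (n - z) - C j n + lead j * real z * (real (j div 2) * real n ^ (j div 2 - 1)))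
         - lead j * ((real (j div 2) * real n ^ (j div 2 - 1)) * real z))"
    by (rule poly_bound_diff) (rule err_rate_nonneg2)
  then show ?thesis by (rule poly_bound_cong) (simp add: algebra_simps)
qed

text \<open>Three replacements of the same cost: \<open>C j (n - z)\<close> by \<open>C j n\<close>,
  this by its main term, and \<open>D n z\<close> by \<open>1 - z\<close>.\<close>

lemma summand_approx:
  assumes "small_error (j div 2) (err j)"
  shows "poly_bound (err_rate (Suc (j div 2)))
    (\<lambda>n z. C j (n - z) * D n z ^ i - lead j * real n ^ (j div 2) * (1 - real z) ^ i)"
proof -
  have Di: "poly_bound (\<lambda>n. 1) (\<lambda>n z. D n z ^ i)" by (intro poly_bound_power poly_bound_D)
  have a: "poly_bound (err_rate (Suc (j div 2))) (\<lambda>n z. (C j (n - z) - C j n) * D n z ^ i)"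
    by (intro poly_bound_mult1 C_increment_coarse assms Di)
  have b: "poly_bound (err_rate (Suc (j div 2))) (\<lambda>n z. err j n * D n z ^ i)"
    using assms unfolding small_error_def by (intro poly_bound_mult1 Di) blast
  have "poly_bound (\<lambda>n. real n ^ (j div 2) * err_rate (Suc 0) n)
      (\<lambda>n z. real n ^ (j div 2) * (D n z ^ i - (1 - real z) ^ i))"
    by (intro poly_bound_mult poly_bound_self D_power_approx) (auto simp: err_rate_1)
  then have "poly_bound (err_rate (Suc (j div 2)))
      (\<lambda>n z. real n ^ (j div 2) * (D n z ^ i - (1 - real z) ^ i))"
    by (rule poly_bound_mono[where C = 1]) (use power_div_le_err_rate in \<open>auto simp: err_rate_1\<close>)
  then have c: "poly_bound (err_rate (Suc (j div 2)))
      (\<lambda>n z. lead j * (real n ^ (j div 2) * (D n z ^ i - (1 - real z) ^ i)))"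
    by (rule poly_bound_cmult)
  have "poly_bound (err_rate (Suc (j div 2)))
     (\<lambda>n z. ((C j (n - z) - C j n) * D n z ^ i + err j n * D n z ^ i)
        + lead j * (real n ^ (j div 2) * (D n z ^ i - (1 - real z) ^ i)))"
    by (intro poly_bound_add a b c err_rate_nonneg2)
  then show ?thesis by (rule poly_bound_cong) (simp add: C_eq algebra_simps)
qed

lemma mean_summand_approx:
  assumes "small_error (j div 2) (err j)"
    and s: "poly_bound (err_rate (Suc 0)) (\<lambda>n z. succ_mean n (\<lambda>z. (1 - real z) ^ i) - s)"
  shows "poly_bound (err_rate (Suc (j div 2)))
    (\<lambda>n z. succ_mean n (\<lambda>z. C j (n - z) * D n z ^ i) - lead j * s * real n ^ (j div 2))"
proof -
  have a: "poly_bound (err_rate (Suc (j div 2))) (\<lambda>n z. succ_mean n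
      (\<lambda>z. C j (n - z) * D n z ^ i - lead j * real n ^ (j div 2) * (1 - real z) ^ i))"
    by (intro poly_bound_succ_mean summand_approx assms err_rate_nonneg2)
  have "poly_bound (\<lambda>n. real n ^ (j div 2) * err_rate (Suc 0) n)
      (\<lambda>n z. real n ^ (j div 2) * (succ_mean n (\<lambda>z. (1 - real z) ^ i) - s))"
    by (intro poly_bound_mult poly_bound_self s) (auto simp: err_rate_1)
  then have "poly_bound (err_rate (Suc (j div 2)))
      (\<lambda>n z. real n ^ (j div 2) * (succ_mean n (\<lambda>z. (1 - real z) ^ i) - s))"
    by (rule poly_bound_mono[where C = 1]) (use power_div_le_err_rate in \<open>auto simp: err_rate_1\<close>)
  then have b: "poly_bound (err_rate (Suc (j div 2)))
      (\<lambda>n z. lead j * (real n ^ (j div 2) * (succ_mean n (\<lambda>z. (1 - real z) ^ i) - s)))"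
    by (rule poly_bound_cmult)
  show ?thesis
  proof (rule poly_bound_cong[OF poly_bound_add[OF a b err_rate_nonneg2]])
    fix n z :: nat
    show "succ_mean n (\<lambda>z. C j (n - z) * D n z ^ i - lead j * real n ^ (j div 2) * (1 - real z) ^ i)
        + lead j * (real n ^ (j div 2) * (succ_mean n (\<lambda>z. (1 - real z) ^ i) - s))
      = succ_mean n (\<lambda>z. C j (n - z) * D n z ^ i) - lead j * s * real n ^ (j div 2)"
      unfolding succ_mean_diff succ_mean_cmult by (simp add: algebra_simps)
  qed
qed

lemma mean_summand_2:
  assumes "small_error (j div 2) (err j)"
  shows "poly_bound (err_rate (Suc (j div 2)))
    (\<lambda>n z. succ_mean n (\<lambda>z. C j (n - z) * D n z ^ 2) - lead j * 1 * real n ^ (j div 2))"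
proof (rule mean_summand_approx[OF assms])
  show "poly_bound (err_rate (Suc 0)) (\<lambda>n z. succ_mean n (\<lambda>z. (1 - real z) ^ 2) - 1)"
  proof (rule poly_bound_boundedI)
    fix n :: nat assume n: "n \<ge> 2"
    have "(1 - real z) ^ 2 = 1 - real z + real z * (real z - 1)" for z
      by (simp add: power2_eq_square algebra_simps)
    then have "succ_mean n (\<lambda>z. (1 - real z) ^ 2) - 1 = - 1 / real n"
      using succ_mean_falling_moments(1,2)[OF n] by (simp add: succ_mean_add succ_mean_diff)
    then show "\<bar>succ_mean n (\<lambda>z. (1 - real z) ^ 2) - 1\<bar> \<le> 1 * err_rate (Suc 0) n"
      by (simp add: err_rate_1)
  qed
qed

lemma mean_summand_3:
  assumes "small_error (j div 2) (err j)"
  shows "poly_bound (err_rate (Suc (j div 2)))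
    (\<lambda>n z. succ_mean n (\<lambda>z. C j (n - z) * D n z ^ 3) - lead j * (-1) * real n ^ (j div 2))"
proof (rule mean_summand_approx[OF assms])
  show "poly_bound (err_rate (Suc 0)) (\<lambda>n z. succ_mean n (\<lambda>z. (1 - real z) ^ 3) - (-1))"
  proof (rule poly_bound_boundedI)
    fix n :: nat assume n: "n \<ge> 2"
    have "(1 - real z) ^ 3 = 1 - real z - real z * (real z - 1) * (real z - 2)" for z
      by (simp add: power3_eq_cube algebra_simps)
    then have eq: "succ_mean n (\<lambda>z. (1 - real z) ^ 3) - (-1)
        = 1 / real n - (succ_mean n (\<lambda>z. real z * (real z - 1) * (real z - 2)) - 1)"
      using succ_mean_falling_moments(1)[OF n] by (simp add: succ_mean_diff)
    have "\<bar>succ_mean n (\<lambda>z. (1 - real z) ^ 3) - (-1)\<bar> \<le> 1 / real n + 3 / real n"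
      unfolding eq using succ_mean_falling_moments(3)[OF n] by (simp add: abs_le_iff)
    then show "\<bar>succ_mean n (\<lambda>z. (1 - real z) ^ 3) - (-1)\<bar> \<le> 4 * err_rate (Suc 0) n"
      by (simp add: err_rate_1)
  qed
qed

text \<open>Size alone suffices here: two orders down, even the main term
  \<open>n ^ (j div 2)\<close> lies within the error.\<close>

lemma mean_summand_far:
  assumes "small_error (j div 2) (err j)" "j div 2 + 2 \<le> M"
  shows "poly_bound (err_rate M) (\<lambda>n z. succ_mean n (\<lambda>z. C j (n - z) * D n z ^ i))"
proof -
  have "poly_bound (err_rate M)
    (\<lambda>n z. (C j (n - z) * D n z ^ i - lead j * real n ^ (j div 2) * (1 - real z) ^ i)
      + lead j * (real n ^ (j div 2) * (1 - real z) ^ i))"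
    using assms(2)
    by (intro poly_bound_add poly_bound_cmult poly_bound_mult1 poly_bound_1_minus err_rate_nonneg2
        poly_bound_err_rate_mono[OF summand_approx[OF assms(1)]] poly_bound_err_rate_mono[OF poly_bound_size_power]) auto
  then have "poly_bound (err_rate M) (\<lambda>n z. C j (n - z) * D n z ^ i)"
    by (rule poly_bound_cong) simp
  then show ?thesis by (rule poly_bound_succ_mean) (rule err_rate_nonneg2)
qed

text \<open>Since \<open>D\<close> is centred, \<open>C j (n - z)\<close> may be replaced by its increment.\<close>

lemma mean_summand_1:
  assumes "small_error (j div 2) (err j)"
  shows "poly_bound (err_rate (j div 2))
    (\<lambda>n z. succ_mean n (\<lambda>z. C j (n - z) * D n z) - lead j * (real (j div 2) * real n ^ (j div 2 - 1)))"
proof -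
  define J where "J = j div 2"
  define p where "p n = real J * real n ^ (J - 1)" for n :: nat
  have a: "poly_bound (err_rate J) (\<lambda>n z. (C j (n - z) - C j n + lead j * real z * p n) * D n z)"
    using C_increment[OF assms] unfolding p_def J_def by (intro poly_bound_mult1 poly_bound_D)
  have "poly_bound (\<lambda>n. p n * err_rate (Suc 0) n) (\<lambda>n z. p n * (D n z - (1 - real z)))"
    by (intro poly_bound_mult poly_bound_self D_approx) (auto simp: err_rate_1 p_def)
  then have "poly_bound (err_rate J) (\<lambda>n z. p n * (D n z - (1 - real z)))"
    by (rule poly_bound_mono[where C = "real J"])
      (use power_pred_div_le_err_rate[of _ J] in \<open>auto simp: err_rate_1 p_def\<close>)
  then have b: "poly_bound (err_rate J) (\<lambda>n z. lead j * (p n * (D n z - (1 - real z)) * real z))"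
    by (intro poly_bound_cmult poly_bound_mult1[OF _ poly_bound_var])
  have "poly_bound (err_rate J) (\<lambda>n z. (C j (n - z) - C j n + lead j * real z * p n) * D n z
      - lead j * (p n * (D n z - (1 - real z)) * real z))"
    by (intro poly_bound_diff a b err_rate_nonneg2)
  then have "poly_bound (err_rate J) (\<lambda>n z. C j (n - z) * D n z - C j n * D n z
    - lead j * p n * (real z * (real z - 1)))"
    by (rule poly_bound_cong) (simp add: algebra_simps)
  then have c: "poly_bound (err_rate J) (\<lambda>n z. succ_mean n
      (\<lambda>z. C j (n - z) * D n z - C j n * D n z - lead j * p n * (real z * (real z - 1))))"
    by (rule poly_bound_succ_mean) (rule err_rate_nonneg2)
  \<comment> \<open>Compensates for \<open>E (Z * (Z - 1))\<close> being \<open>1 - 2 / n\<close>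
    instead of 1.\<close>
  have d: "poly_bound (err_rate J) (\<lambda>n z. (-2 * lead j) * (p n / real n))"
    using poly_bound_power_pred_div[of J] unfolding p_def by (rule poly_bound_cmult)
  have "poly_bound (err_rate J) (\<lambda>n z. succ_mean n (\<lambda>z. C j (n - z) * D n z) - lead j * p n)"
  proof (rule poly_bound_cong[OF poly_bound_add[OF c d err_rate_nonneg2]])
    fix n z :: nat assume n: "n \<ge> 2"
    show "succ_mean n (\<lambda>z. C j (n - z) * D n z - C j n * D n z - lead j * p n * (real z * (real z - 1)))
       + (-2 * lead j) * (p n / real n) = succ_mean n (\<lambda>z. C j (n - z) * D n z) - lead j * p n"
      unfolding succ_mean_diff succ_mean_cmult mean_D[OF n] succ_mean_falling_moments(2)[OF n]
      using n by (simp add: field_simps)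
  qed
  then show ?thesis by (simp add: p_def J_def)
qed

section \<open>The inhomogeneous term and the induction on the order\<close>

definition source :: "nat \<Rightarrow> nat \<Rightarrow> real" where
  "source m n = (\<Sum>j<m. real (m choose j) * succ_mean n (\<lambda>z. C j (n - z) * D n z ^ (m - j)))"

lemma C_minus_mean_C:
  assumes "n \<ge> 2"
  shows "C m n - succ_mean n (\<lambda>z. C m (n - z)) = source m n"
proof -
  have "C m n = succ_mean n (\<lambda>z. \<Sum>j\<le>m. real (m choose j) * (C j (n - z) * D n z ^ (m - j)))"
    using C_rec[OF assms] by (simp add: D_def mult.assoc)
  also have "\<dots> = source m n + succ_mean n (\<lambda>z. C m (n - z))"
    unfolding succ_mean_sum succ_mean_cmult source_def by (simp flip: lessThan_Suc_atMost)
  finally show ?thesis by simp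
qed

text \<open>Parity decides which \<open>j\<close> count. For even \<open>m\<close> only
  \<open>j = m - 2\<close> reaches the leading order: \<open>C (m - 1)\<close> is an odd moment,
  whose increments are one order smaller. For odd \<open>m\<close> the terms \<open>m - 1\<close>,
  \<open>m - 2\<close> and \<open>m - 3\<close> all reach it.\<close>

lemma source_approx:
  assumes "m \<ge> 2" and small: "\<And>j. j < m \<Longrightarrow> small_error (j div 2) (err j)"
  shows "poly_bound (err_rate (m div 2))
     (\<lambda>n z. source m n - lead m * (real (m div 2) * real n ^ (m div 2 - 1)))"
proof -
  obtain M where M: "m = 2 * Suc M \<or> m = 2 * Suc M + 1"
  proof (cases "even m")
    case True
    then obtain k where "m = 2 * k" by blast
    with assms(1) that[of "k - 1"] show thesis by simp
  next
    case False
    then obtain k where "m = 2 * k + 1" by (elim oddE)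
    with assms(1) that[of "k - 1"] show thesis by simp
  qed
  have far: "poly_bound (err_rate (Suc M)) (\<lambda>n z. \<Sum>j<2 * M.
      real (m choose j) * succ_mean n (\<lambda>z. C j (n - z) * D n z ^ (m - j)))"
  proof (intro poly_bound_sum poly_bound_cmult err_rate_nonneg2)
    fix j assume "j \<in> {..<2 * M}"
    then show "poly_bound (err_rate (Suc M)) (\<lambda>n z. succ_mean n (\<lambda>z. C j (n - z) * D n z ^ (m - j)))"
      using M by (intro mean_summand_far small) auto
  qed
  from M show ?thesis
  proof
    assume m: "m = 2 * Suc M"
    have a: "poly_bound (err_rate (Suc M)) (\<lambda>n z. real (m choose 2) *
       (succ_mean n (\<lambda>z. C (2 * M) (n - z) * D n z ^ 2) - lead (2 * M) * 1 * real n ^ M))"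
      using mean_summand_2[OF small[of "2 * M"]] m by (intro poly_bound_cmult) simp
    have "poly_bound (err_rate (Suc M)) (\<lambda>n z.
       (succ_mean n (\<lambda>z. C (2 * M + 1) (n - z) * D n z) - lead (2 * M + 1) * (real M * real n ^ (M - 1)))
       + lead (2 * M + 1) * (real M * real n ^ (M - 1)))"
      using poly_bound_err_rate_mono[OF mean_summand_1[OF small[of "2 * M + 1"]], of "Suc M"] m
      by (intro poly_bound_add poly_bound_cmult poly_bound_power_pred err_rate_nonneg2) simp_all
    then have b: "poly_bound (err_rate (Suc M)) (\<lambda>n z. real m * succ_mean n (\<lambda>z. C (2 * M + 1) (n - z) * D n z))"
      by (intro poly_bound_cmult) simp
    have "poly_bound (err_rate (Suc M)) (\<lambda>n z. source m n - lead m * (real (Suc M) * real n ^ M))"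
    proof (rule poly_bound_cong[OF poly_bound_add[OF poly_bound_add[OF far a] b]])
      fix n z :: nat
      have 1: "{..<m} = {..<Suc (Suc (2 * M))}" using m by simp
      have 2: "m choose (2 * M) = m choose 2" "m choose Suc (2 * M) = m" "m - 2 * M = 2" "m - Suc (2 * M) = 1"
        using binomial_symmetric[of 2 m] binomial_symmetric[of 1 m] m by simp_all
      have "source m n = (\<Sum>j<2 * M. real (m choose j) * succ_mean n (\<lambda>z. C j (n - z) * D n z ^ (m - j)))
         + real (m choose 2) * succ_mean n (\<lambda>z. C (2 * M) (n - z) * D n z ^ 2)
         + real m * succ_mean n (\<lambda>z. C (2 * M + 1) (n - z) * D n z)"
        unfolding source_def 1 sum.lessThan_Suc 2 by simp
      moreover have "real (m choose 2) * lead (2 * M) = lead m * real (Suc M)"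
        using lead_even_recursion[of M] m by simp
      then have "real (m choose 2) * (lead (2 * M) * 1 * real n ^ M) = lead m * (real (Suc M) * real n ^ M)"
        by (simp add: mult.assoc[symmetric])
      ultimately show "(\<Sum>j<2 * M. real (m choose j) * succ_mean n (\<lambda>z. C j (n - z) * D n z ^ (m - j)))
        + real (m choose 2) * (succ_mean n (\<lambda>z. C (2 * M) (n - z) * D n z ^ 2) - lead (2 * M) * 1 * real n ^ M)
        + real m * succ_mean n (\<lambda>z. C (2 * M + 1) (n - z) * D n z)
          = source m n - lead m * (real (Suc M) * real n ^ M)"
        unfolding right_diff_distrib by simp
    qed (auto intro: err_rate_nonneg2)
    then show ?thesis by (simp add: m)
  next
    assume m: "m = 2 * Suc M + 1"
    have a: "poly_bound (err_rate (Suc M)) (\<lambda>n z. real (m choose 3) *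
       (succ_mean n (\<lambda>z. C (2 * M) (n - z) * D n z ^ 3) - lead (2 * M) * (-1) * real n ^ M))"
      using mean_summand_3[OF small[of "2 * M"]] m by (intro poly_bound_cmult) simp
    have b: "poly_bound (err_rate (Suc M)) (\<lambda>n z. real (m choose 2) *
       (succ_mean n (\<lambda>z. C (2 * M + 1) (n - z) * D n z ^ 2) - lead (2 * M + 1) * 1 * real n ^ M))"
      using mean_summand_2[OF small[of "2 * M + 1"]] m by (intro poly_bound_cmult) simp
    have c: "poly_bound (err_rate (Suc M)) (\<lambda>n z. real m *
       (succ_mean n (\<lambda>z. C (2 * M + 2) (n - z) * D n z) - lead (2 * M + 2) * (real (Suc M) * real n ^ M)))"
      using mean_summand_1[OF small[of "2 * M + 2"]] m by (intro poly_bound_cmult) simp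
    have "poly_bound (err_rate (Suc M)) (\<lambda>n z. source m n - lead m * (real (Suc M) * real n ^ M))"
    proof (rule poly_bound_cong[OF poly_bound_add[OF poly_bound_add[OF poly_bound_add[OF far a] b] c]])
      fix n z :: nat
      have 1: "{..<m} = {..<Suc (Suc (Suc (2 * M)))}" using m by simp
      have 2: "m choose (2 * M) = m choose 3" "m choose Suc (2 * M) = m choose 2" "m choose Suc (Suc (2 * M)) = m"
        "m - 2 * M = 3" "m - Suc (2 * M) = 2" "m - Suc (Suc (2 * M)) = 1"
        using binomial_symmetric[of 3 m] binomial_symmetric[of 2 m] binomial_symmetric[of 1 m] m by simp_all
      have "source m n = (\<Sum>j<2 * M. real (m choose j) * succ_mean n (\<lambda>z. C j (n - z) * D n z ^ (m - j)))
         + real (m choose 3) * succ_mean n (\<lambda>z. C (2 * M) (n - z) * D n z ^ 3)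
         + real (m choose 2) * succ_mean n (\<lambda>z. C (2 * M + 1) (n - z) * D n z ^ 2)
         + real m * succ_mean n (\<lambda>z. C (2 * M + 2) (n - z) * D n z)"
        unfolding source_def 1 sum.lessThan_Suc 2 by simp
      moreover have "real m * (lead (2 * M + 2) * (real (Suc M) * x)) + real (m choose 2) * (lead (2 * M + 1) * 1 * x)
           + real (m choose 3) * (lead (2 * M) * (-1) * x) = lead m * (real (Suc M) * x)" for x
      proof -
        have "real m * lead (2 * M + 2) * real (Suc M) + real (m choose 2) * lead (2 * M + 1)
            - real (m choose 3) * lead (2 * M) = real (Suc M) * lead m"
          using lead_odd_recursion[of M] unfolding m by simp
        from arg_cong[OF this, of "\<lambda>y. y * x"] show ?thesis by (simp add: algebra_simps)
      qed
      from this[of "real n ^ M"] have "real m * (lead (2 * M + 2) * (real (Suc M) * real n ^ M))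
        + real (m choose 2) * (lead (2 * M + 1) * 1 * real n ^ M)
           + real (m choose 3) * (lead (2 * M) * (-1) * real n ^ M) = lead m * (real (Suc M) * real n ^ M)" .
      ultimately show "(\<Sum>j<2 * M. real (m choose j) * succ_mean n (\<lambda>z. C j (n - z) * D n z ^ (m - j)))
        + real (m choose 3) * (succ_mean n (\<lambda>z. C (2 * M) (n - z) * D n z ^ 3) - lead (2 * M) * (-1) * real n ^ M)
        + real (m choose 2) * (succ_mean n (\<lambda>z. C (2 * M + 1) (n - z) * D n z ^ 2)
          - lead (2 * M + 1) * 1 * real n ^ M)
        + real m * (succ_mean n (\<lambda>z. C (2 * M + 2) (n - z) * D n z) - lead (2 * M + 2) * (real (Suc M) * real n ^ M))
        = source m n - lead m * (real (Suc M) * real n ^ M)"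
        unfolding right_diff_distrib by linarith
    qed (auto intro: err_rate_nonneg2)
    then show ?thesis by (simp add: m)
  qed
qed

text \<open>Up to the error, \<open>n ^ M - E (n - Z) ^ M\<close> equals
  \<open>M * n ^ (M - 1)\<close> times \<open>E Z\<close>, which is exactly what
  \<open>source\<close> contains; the leading parts cancel.\<close>

lemma err_recursion:
  assumes "m \<ge> 2" and small: "\<And>j. j < m \<Longrightarrow> small_error (j div 2) (err j)"
  shows "poly_bound (err_rate (m div 2)) (\<lambda>n z. err m n - succ_mean n (\<lambda>z. err m (n - z)))"
proof -
  define M where "M = m div 2"
  define p where "p n = real M * real n ^ (M - 1)" for n :: nat
  have a: "poly_bound (err_rate M) (\<lambda>n z. source m n - lead m * p n)"
    using source_approx[OF assms] by (simp add: M_def p_def)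
  have "poly_bound (err_rate M) (\<lambda>n z. succ_mean n (\<lambda>z. real (n - z) ^ M - real n ^ M
    + real M * real z * real n ^ (M - 1)))"
    by (intro poly_bound_succ_mean poly_bound_power_step err_rate_nonneg2)
  then have b: "poly_bound (err_rate M) (\<lambda>n z. lead m * succ_mean n (\<lambda>z. real (n - z) ^ M - real n ^ M
    + p n * real z))"
    by (intro poly_bound_cmult) (simp add: p_def mult_ac)
  \<comment> \<open>Accounts for the \<open>1 / n\<close> in \<open>E Z = 1 - 1 / n\<close>.\<close>
  have c: "poly_bound (err_rate M) (\<lambda>n z. lead m * (p n / real n))"
    using poly_bound_power_pred_div[of M] unfolding p_def by (rule poly_bound_cmult)
  show ?thesis unfolding M_def[symmetric]
  proof (rule poly_bound_cong[OF poly_bound_add[OF poly_bound_add[OF a b] c]])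
    fix n z :: nat assume n: "n \<ge> 2"
    have "err m n - succ_mean n (\<lambda>z. err m (n - z)) =
      (C m n - succ_mean n (\<lambda>z. C m (n - z))) - lead m * real n ^ M + lead m * succ_mean n (\<lambda>z. real (n - z) ^ M)"
      by (simp add: err_def main_term_lead M_def succ_mean_diff succ_mean_cmult)
    then show "source m n - lead m * p n + lead m * succ_mean n (\<lambda>z. real (n - z) ^ M - real n ^ M + p n * real z)
       + lead m * (p n / real n) = err m n - succ_mean n (\<lambda>z. err m (n - z))"
      unfolding C_minus_mean_C[OF n] succ_mean_diff succ_mean_add succ_mean_cmult succ_mean_falling_moments(1)[OF n]
      by (simp add: algebra_simps)
  qed (auto intro: err_rate_nonneg2)
qed

lemma err_increments_if_small:
  assumes "m \<ge> 2" "\<And>j. j < m \<Longrightarrow> small_error (j div 2) (err j)"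
  obtains K where "K \<ge> 0" "\<And>n. n \<ge> 2 \<Longrightarrow> \<bar>err m n - err m (n - 1)\<bar> \<le> K * err_rate (m div 2) n"
proof (rule error_increments[where h = "err m" and M = "m div 2"
      and r = "\<lambda>n. err m n - succ_mean n (\<lambda>z. err m (n - z))"])
  show "poly_bound (err_rate (m div 2)) (\<lambda>n z. err m n - succ_mean n (\<lambda>z. err m (n - z)))"
    using assms by (rule err_recursion)
qed (use assms(1) that in auto)

lemma small_error_err: "small_error (m div 2) (err m)"
proof (induction m rule: less_induct)
  case (less m)
  consider "m = 0" | "m = Suc 0" | "m \<ge> 2" by linarith
  then show ?case
  proof cases
    case 1
    have "err m n = 0" if "n \<ge> 1" for n using that by (simp add: err_def 1 main_term_lead lead_def C_0)
    then show ?thesis unfolding small_error_def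
      by (intro conjI poly_boundI[where K = 0]) auto
  next
    case 2
    have "err m n = 0" if "n \<ge> 1" for n using that by (simp add: err_def 2 main_term_lead lead_def C_1)
    then show ?thesis unfolding small_error_def
      by (intro conjI poly_boundI[where K = 0]) auto
  next
    case 3
    obtain K where "K \<ge> 0" "\<And>n. n \<ge> 2 \<Longrightarrow> \<bar>err m n - err m (n - 1)\<bar> \<le> K * err_rate (m div 2) n"
      using err_increments_if_small[OF 3 less] by blast
    then show ?thesis using 3 by (intro small_error_of_increments[where K = K]) auto
  qed
qed

lemma err_increments:
  assumes "m \<ge> 2"
  obtains K where "\<And>n. n \<ge> 2 \<Longrightarrow> \<bar>err m n - err m (n - 1)\<bar> \<le> K * err_rate (m div 2) n"
  using err_increments_if_small[OF assms small_error_err] by blast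

lemma err_bound:
  obtains K where "\<And>n. n \<ge> 2 \<Longrightarrow> \<bar>err m n\<bar> \<le> K * err_rate (Suc (m div 2)) n"
  using small_error_err[of m] poly_bound_boundedE unfolding small_error_def by blast

end

subsection \<open>The merging process\<close>

abbreviation shuffles_step :: "(nat \<Rightarrow> nat list) measure" where
  "shuffles_step \<equiv> \<Pi>\<^sub>M k\<in>UNIV. measure_pmf (random_permutation k)"

lemma prob_space_shuffles_step: "prob_space shuffles_step"
  by (intro prob_space_PiM prob_space_measure_pmf)

lemma prob_space_shuffles_space: "prob_space shuffles_space"
  unfolding shuffles_space_def by (intro prob_space.prob_space_stream_space prob_space_shuffles_step)

interpretation shuffles: prob_space shuffles_space
  by (rule prob_space_shuffles_space)

lemma space_shuffles_space [simp]: "space shuffles_space = UNIV"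
  by (simp add: shuffles_space_def space_stream_space space_PiM)

text \<open>The coordinate read at time \<open>t\<close> is itself random; since the states are
  countable, it may be fixed as \<open>k\<close>.\<close>

lemma measurable_elements_left [measurable]:
  "(\<lambda>\<omega>. elements_left n \<omega> t) \<in> measurable shuffles_space (count_space UNIV)"
proof (induction t)
  case 0
  then show ?case by simp
next
  case (Suc t)
  have "(\<lambda>\<omega>. card (blocks ((\<omega> !! t) k))) \<in> measurable shuffles_space (count_space UNIV)" for k
  proof -
    have 1: "(\<lambda>\<omega>. \<omega> !! t) \<in> measurable shuffles_space shuffles_step"
      unfolding shuffles_space_def by (rule measurable_snth)
    have 2: "(\<lambda>p. p k) \<in> measurable shuffles_step (measure_pmf (random_permutation k))"
      by (rule measurable_component_singleton) simp
    have 3: "(\<lambda>\<tau>. card (blocks \<tau>)) \<in> measurable (measure_pmf (random_permutation k)) (count_space UNIV)"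
      by simp
    show ?thesis by (rule measurable_compose[OF measurable_compose[OF 1 2] 3])
  qed
  from measurable_compose_countable[OF this Suc] show ?case by simp
qed

lemma measurable_X [measurable]: "X n \<in> measurable shuffles_space (count_space UNIV)"
  unfolding X_def[abs_def] by measurable

text \<open>Pathwise form of the Markov property: the definition peels off the last step, whereas
  the recursions for moments need the first.\<close>

lemma elements_left_Stream:
  "elements_left n (p ## \<omega>) (Suc t) = elements_left (card (blocks (p n))) \<omega> t"
  by (induction t) simp_all

lemma card_blocks_permutation:
  assumes "\<tau> \<in> permutations_of_set {1..n}"
  shows "card (blocks \<tau>) = n - successions \<tau>"
  using assms card_blocks[of \<tau>] length_finite_permutations_of_set[OF assms]
  by (auto simp: permutations_of_set_def)

lemma card_blocks_permutation_bounds: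
  assumes "\<tau> \<in> permutations_of_set {1..n}" "n \<ge> 1"
  shows "1 \<le> card (blocks \<tau>)" "card (blocks \<tau>) \<le> n"
  using card_blocks_permutation[OF assms(1)] successions_perm_less[OF assms] by auto

text \<open>First-step analysis for nonnegative integrals, usable before integrability of
  \<open>X\<close> is known. The hypothesis \<open>step\<close> is only almost sure, because
  \<open>X\<close> is unspecified on paths that never end.\<close>

lemma nn_integral_first_step:
  fixes g :: "nat \<Rightarrow> real"
  assumes n: "n \<ge> 1" and f: "f \<in> borel_measurable shuffles_space"
    and g: "\<And>k. 1 \<le> k \<Longrightarrow> k \<le> n \<Longrightarrow> (\<integral>\<^sup>+\<omega>. G k \<omega> \<partial>shuffles_space) = ennreal (g k) \<and> g k \<ge> 0"
    and step: "\<And>p. p n \<in> permutations_of_set {1..n} \<Longrightarrow> AE \<omega> in shuffles_space. f (p ## \<omega>) = G (card (blocks (p n))) \<omega>"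
  shows "(\<integral>\<^sup>+\<omega>. f \<omega> \<partial>shuffles_space) = ennreal (succ_mean n (\<lambda>z. g (n - z)))"
proof -
  interpret S: prob_space shuffles_step by (rule prob_space_shuffles_step)
  let ?P = "permutations_of_set {1..n}" and ?M = "measure_pmf (random_permutation n)"
  have P: "finite ?P" "?P \<noteq> {}" "card ?P = fact n" by simp_all
  have comp: "distr shuffles_step ?M (\<lambda>p. p n) = ?M"
    by (rule distr_PiM_component) (auto simp: prob_space_measure_pmf)
  have "AE \<tau> in ?M. \<tau> \<in> ?P"
    unfolding random_permutation_def by (simp add: AE_measure_pmf_iff set_pmf_of_set[OF P(2,1)])
  then have AE: "AE p in shuffles_step. p n \<in> ?P"
    by (intro AE_PiM_component) (auto simp: prob_space_measure_pmf)
  have "(\<integral>\<^sup>+\<omega>. f \<omega> \<partial>shuffles_space) = (\<integral>\<^sup>+p. (\<integral>\<^sup>+\<omega>. f (p ## \<omega>) \<partial>shuffles_space) \<partial>shuffles_step)"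
    using f unfolding shuffles_space_def by (rule S.nn_integral_stream_space)
  also have "\<dots> = (\<integral>\<^sup>+p. (\<integral>\<^sup>+\<omega>. G (card (blocks (p n))) \<omega> \<partial>shuffles_space) \<partial>shuffles_step)"
    using AE by (intro nn_integral_cong_AE) (auto elim!: eventually_mono intro!: nn_integral_cong_AE step)
  also have "\<dots> = (\<integral>\<^sup>+\<tau>. (\<integral>\<^sup>+\<omega>. G (card (blocks \<tau>)) \<omega> \<partial>shuffles_space) \<partial>distr shuffles_step ?M (\<lambda>p. p n))"
    by (subst nn_integral_distr) auto
  also have "\<dots> = (\<integral>\<^sup>+\<tau>. (\<integral>\<^sup>+\<omega>. G (card (blocks \<tau>)) \<omega> \<partial>shuffles_space) \<partial>?M)"
    unfolding comp ..
  also have "\<dots> = (\<Sum>\<tau>\<in>?P. \<integral>\<^sup>+\<omega>. G (card (blocks \<tau>)) \<omega> \<partial>shuffles_space) / fact n"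
    unfolding random_permutation_def by (subst nn_integral_pmf_of_set[OF P(2,1)]) (simp add: P(3))
  also have "(\<Sum>\<tau>\<in>?P. \<integral>\<^sup>+\<omega>. G (card (blocks \<tau>)) \<omega> \<partial>shuffles_space) = (\<Sum>\<tau>\<in>?P. ennreal (g (n - successions \<tau>)))"
    using n g card_blocks_permutation_bounds by (intro sum.cong) (auto simp: card_blocks_permutation)
  also have "\<dots> = ennreal (\<Sum>\<tau>\<in>?P. g (n - successions \<tau>))"
    using n g card_blocks_permutation_bounds[of _ n]
    by (intro sum_ennreal) (auto simp flip: card_blocks_permutation)
  also have "\<dots> / fact n = ennreal (succ_mean n (\<lambda>z. g (n - z)))"
  proof -
    have "(\<Sum>\<tau>\<in>?P. g (n - successions \<tau>)) \<ge> 0"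
      using n g card_blocks_permutation_bounds[of _ n]
      by (intro sum_nonneg) (auto simp flip: card_blocks_permutation)
    then have "ennreal (\<Sum>\<tau>\<in>?P. g (n - successions \<tau>)) / ennreal (fact n) = ennreal (succ_mean n (\<lambda>z. g (n - z)))"
      unfolding succ_mean_def by (intro divide_ennreal) auto
    moreover have "ennreal (fact n) = fact n"
      by (metis ennreal_of_nat_eq_real_of_nat of_nat_fact)
    ultimately show ?thesis by simp
  qed
  finally show ?thesis .
qed

section \<open>Exponential tail bound and termination\<close>

definition survival :: "nat \<Rightarrow> nat \<Rightarrow> real" where
  "survival n t = measure shuffles_space {\<omega>. elements_left n \<omega> t \<noteq> 1}"

lemma sets_survival: "{\<omega>. elements_left n \<omega> t \<noteq> 1} \<in> sets shuffles_space"
proof -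
  have "{\<omega> \<in> space shuffles_space. elements_left n \<omega> t \<noteq> 1} \<in> sets shuffles_space" by measurable
  then show ?thesis by simp
qed

lemma survival_Suc:
  assumes "n \<ge> 1"
  shows "survival n (Suc t) = succ_mean n (\<lambda>z. survival (n - z) t)"
proof -
  have nn: "(\<integral>\<^sup>+\<omega>. indicator {\<omega>. elements_left k \<omega> s \<noteq> 1} \<omega> \<partial>shuffles_space) = ennreal (survival k s)" for k s
    unfolding survival_def using sets_survival by (simp add: shuffles.emeasure_eq_measure)
  have "ennreal (survival n (Suc t)) = ennreal (succ_mean n (\<lambda>z. survival (n - z) t))"
    unfolding nn[symmetric]
  proof (rule nn_integral_first_step[OF assms])
    show "indicator {\<omega>. elements_left n \<omega> (Suc t) \<noteq> 1} \<in> borel_measurable shuffles_space"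
      by (intro borel_measurable_indicator sets_survival)
    show "(\<integral>\<^sup>+\<omega>. indicator {\<omega>. elements_left k \<omega> t \<noteq> 1} \<omega> \<partial>shuffles_space)
      = ennreal (survival k t) \<and> survival k t \<ge> 0" for k
      by (simp only: nn) (simp add: survival_def)
    show "AE \<omega> in shuffles_space. indicator {\<omega>. elements_left n \<omega> (Suc t) \<noteq> 1} (p ## \<omega>)
        = indicator {\<omega>. elements_left (card (blocks (p n))) \<omega> t \<noteq> 1} \<omega>" for p
      by (rule AE_I2) (simp add: indicator_def elements_left_Stream del: elements_left.simps)
  qed
  moreover have "succ_mean n (\<lambda>z. survival (n - z) t) \<ge> 0"
    using succ_mean_mono[of n "\<lambda>z. 0" "\<lambda>z. survival (n - z) t"] assms by (simp add: survival_def)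
  ultimately show ?thesis by (simp add: survival_def)
qed

lemma survival_1: "survival 1 t = 0"
proof (induction t)
  case (Suc t)
  have "survival 1 (Suc t) = succ_mean 1 (\<lambda>z. survival (1 - z) t)"
    by (rule survival_Suc) simp
  also have "\<dots> = succ_mean 1 (\<lambda>z. 0)"
    by (rule succ_mean_cong) (use Suc in auto)
  finally have "survival 1 (Suc t) = succ_mean 1 (\<lambda>z. 0)" .
  then show ?case by simp
qed (simp add: survival_def)

text \<open>\<open>2 ^ n\<close> acts as a Lyapunov function: a step with a succession at least
  halves it, and for \<open>n \<ge> 2\<close> this has probability at least \<open>1 / 2\<close>, so
  the mean shrinks by the factor \<open>3 / 4\<close>. At \<open>n = 1\<close> the process has
  ended.\<close>

lemma survival_le: "n \<ge> 1 \<Longrightarrow> survival n t \<le> 2 ^ n * (3 / 4) ^ t"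
proof (induction t arbitrary: n)
  case 0
  have "survival n 0 \<le> 1" unfolding survival_def by (rule shuffles.prob_le_1)
  also have "(1::real) \<le> 2 ^ n" by simp
  finally show ?case by simp
next
  case (Suc t)
  show ?case
  proof (cases "n = 1")
    case False
    with Suc.prems have n: "n \<ge> 2" by simp
    have "survival n (Suc t) \<le> succ_mean n (\<lambda>z. 2 ^ n * (3 / 4) ^ t * (1 - 1 / 2 * of_bool (z \<ge> 1)))"
      unfolding survival_Suc[OF Suc.prems]
    proof (rule succ_mean_mono[OF Suc.prems])
      fix z assume z: "z < n"
      have "(2::real) ^ (n - z) \<le> 2 ^ n * (1 - 1 / 2 * of_bool (z \<ge> 1))"
      proof (cases "z \<ge> 1")
        case True
        have "(2::real) ^ (n - z) \<le> 2 ^ (n - 1)" using True by (intro power_increasing) auto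
        also have "\<dots> = 2 ^ n * (1 / 2)" using n by (cases n) auto
        finally show ?thesis using True by simp
      qed simp
      then have "2 ^ (n - z) * (3 / 4 :: real) ^ t \<le> 2 ^ n * (1 - 1 / 2 * of_bool (z \<ge> 1)) * (3 / 4) ^ t"
        by (rule mult_right_mono) simp
      also have "\<dots> = 2 ^ n * (3 / 4) ^ t * (1 - 1 / 2 * of_bool (z \<ge> 1))"
        by (simp only: mult_ac)
      finally show "survival (n - z) t \<le> 2 ^ n * (3 / 4) ^ t * (1 - 1 / 2 * of_bool (z \<ge> 1))"
        using Suc.IH[of "n - z"] z by linarith
    qed
    also have "\<dots> = 2 ^ n * (3 / 4) ^ t * (1 - 1 / 2 * succ_mean n (\<lambda>z. of_bool (z \<ge> 1)))"
      unfolding succ_mean_cmult succ_mean_diff by simp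
    also have "\<dots> \<le> 2 ^ n * (3 / 4) ^ t * (3 / 4)"
      using succ_mean_pos_ge_half[OF n] by (intro mult_left_mono) auto
    finally show ?thesis by simp
  qed (use survival_1 in simp)
qed

lemma AE_elements_left_eq_1:
  assumes "n \<ge> 1"
  shows "AE \<omega> in shuffles_space. \<exists>t. elements_left n \<omega> t = 1"
proof -
  let ?A = "{\<omega>. \<forall>t. elements_left n \<omega> t \<noteq> 1}"
  have A: "?A \<in> sets shuffles_space"
  proof -
    have "{\<omega> \<in> space shuffles_space. \<forall>t. elements_left n \<omega> t \<noteq> 1} \<in> sets shuffles_space" by measurable
    then show ?thesis by simp
  qed
  have le: "measure shuffles_space ?A \<le> 2 ^ n * (3 / 4) ^ t" for t
  proof -
    have "measure shuffles_space ?A \<le> survival n t"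
      unfolding survival_def by (rule shuffles.finite_measure_mono[OF _ sets_survival]) auto
    with survival_le[OF assms, of t] show ?thesis by linarith
  qed
  have "(\<lambda>t. 2 ^ n * (3 / 4 :: real) ^ t) \<longlonglongrightarrow> 2 ^ n * 0"
    by (intro tendsto_mult tendsto_const LIMSEQ_realpow_zero) auto
  then have "measure shuffles_space ?A \<le> 2 ^ n * 0"
    by (rule LIMSEQ_le_const) (use le in blast)
  then have "measure shuffles_space ?A = 0" by (simp add: measure_le_0_iff)
  then have "emeasure shuffles_space ?A = 0" by (simp add: shuffles.emeasure_eq_measure)
  then show ?thesis using A by (intro AE_I[where N = ?A]) auto
qed

section \<open>The stopping time and its moments\<close>

lemma elements_left_X:
  assumes "\<exists>t. elements_left n \<omega> t = 1"
  shows "elements_left n \<omega> (X n \<omega>) = 1" "t < X n \<omega> \<Longrightarrow> elements_left n \<omega> t \<noteq> 1"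
  using LeastI_ex[OF assms] not_less_Least unfolding X_def by auto

lemma X_Stream:
  assumes "n \<noteq> 1" "\<exists>t. elements_left (card (blocks (p n))) \<omega> t = 1"
  shows "X n (p ## \<omega>) = Suc (X (card (blocks (p n))) \<omega>)"
proof -
  obtain t where t: "elements_left n (p ## \<omega>) (Suc t) = 1"
    using assms(2) unfolding elements_left_Stream by blast
  have "X n (p ## \<omega>) = Suc (LEAST t. elements_left n (p ## \<omega>) (Suc t) = 1)"
    unfolding X_def by (rule Least_Suc[where P = "\<lambda>t. elements_left n (p ## \<omega>) t = 1", OF t]) (use assms(1) in simp)
  then show ?thesis unfolding elements_left_Stream X_def .
qed

text \<open>\<open>X ^ k\<close> is dominated by the sum of \<open>(t + 1) ^ k\<close> over the
  times \<open>t\<close> at which the process still runs; the term \<open>t = X - 1\<close> alone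
  suffices, and the tail bound beats the polynomial weights.\<close>

lemma integrable_X_power:
  assumes "n \<ge> 1"
  shows "integrable shuffles_space (\<lambda>\<omega>. real (X n \<omega>) ^ k)"
\<comment> \<open>\<open>k = 0\<close> is separate: at \<open>X = 0\<close> the dominating argument
  would have to cover \<open>0 ^ 0 = 1\<close>.\<close>
proof (cases k)
  case (Suc l)
  show ?thesis
  proof (rule integrableI_nonneg)
    let ?h = "\<lambda>t. real (Suc t) ^ k * (2 ^ n * (3 / 4) ^ t)"
    have "AE \<omega> in shuffles_space. ennreal (real (X n \<omega>) ^ k)
        \<le> (\<Sum>t. ennreal (real (Suc t) ^ k) * indicator {\<omega>. elements_left n \<omega> t \<noteq> 1} \<omega>)"
      using AE_elements_left_eq_1[OF assms]
    proof eventually_elim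
      case (elim \<omega>)
      show ?case
      proof (cases "X n \<omega>")
        case 0
        then show ?thesis using Suc by simp
      next
        case t: (Suc t)
        have "elements_left n \<omega> t \<noteq> 1" using elements_left_X(2)[OF elim] t by simp
        then have "ennreal (real (X n \<omega>) ^ k) = ennreal (real (Suc t) ^ k) * indicator {\<omega>. elements_left n \<omega> t \<noteq> 1} \<omega>"
          by (simp add: t)
        also have "\<dots> = (\<Sum>t\<in>{t}. ennreal (real (Suc t) ^ k) * indicator {\<omega>. elements_left n \<omega> t \<noteq> 1} \<omega>)"
          by (simp only: sum.insert sum.empty finite.emptyI empty_iff not_False_eq_True add_0_right)
        also have "\<dots> \<le> (\<Sum>t. ennreal (real (Suc t) ^ k) * indicator {\<omega>. elements_left n \<omega> t \<noteq> 1} \<omega>)"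
          by (rule sum_le_suminf) (auto intro: summableI)
        finally show ?thesis .
      qed
    qed
    then have "(\<integral>\<^sup>+\<omega>. ennreal (real (X n \<omega>) ^ k) \<partial>shuffles_space)
      \<le> (\<integral>\<^sup>+\<omega>. (\<Sum>t. ennreal (real (Suc t) ^ k) * indicator {\<omega>. elements_left n \<omega> t \<noteq> 1} \<omega>) \<partial>shuffles_space)"
      by (rule nn_integral_mono_AE)
    also have "\<dots> = (\<Sum>t. ennreal (real (Suc t) ^ k) * ennreal (survival n t))"
      using sets_survival
      by (subst nn_integral_suminf) (auto simp: nn_integral_cmult survival_def shuffles.emeasure_eq_measure)
    also have "\<dots> \<le> (\<Sum>t. ennreal (?h t))"
      using survival_le[OF assms]
      by (intro suminf_le summableI) (auto simp: survival_def mult_left_mono simp flip: ennreal_mult intro!: ennreal_leI)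
    also have "\<dots> < \<infinity>"
    proof -
      \<comment> \<open>Any ratio strictly between \<open>3 / 4\<close> and 1 would absorb the
        polynomial.\<close>
      have "eventually (\<lambda>t. real (Suc t) ^ k * (3 / 4) ^ t \<le> (7 / 8) ^ t) sequentially"
        by real_asymp
      then have "eventually (\<lambda>t. norm (real (Suc t) ^ k * (3 / 4) ^ t) \<le> (7 / 8) ^ t) sequentially"
        by eventually_elim simp
      then have "summable (\<lambda>t. real (Suc t) ^ k * (3 / 4) ^ t)"
        by (rule summable_comparison_test_ev) (rule summable_geometric, simp)
      then have "summable (\<lambda>t. 2 ^ n * (real (Suc t) ^ k * (3 / 4) ^ t))" by (rule summable_mult)
      then have "summable ?h" by (simp add: mult_ac)
      then have "(\<Sum>t. ennreal (?h t)) = ennreal (\<Sum>t. ?h t)"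
        by (intro suminf_ennreal2) auto
      then show ?thesis by simp
    qed
    finally show "(\<integral>\<^sup>+\<omega>. ennreal (real (X n \<omega>) ^ k) \<partial>shuffles_space) < \<infinity>" .
  qed auto
qed simp

lemma integrable_X_centered_power:
  assumes "n \<ge> 1"
  shows "integrable shuffles_space (\<lambda>\<omega>. (real (X n \<omega>) + c) ^ m)"
  unfolding binomial_ring using integrable_X_power[OF assms] by simp

lemma integral_X_nonneg_step:
  fixes g :: "nat \<Rightarrow> real"
  assumes n: "n \<ge> 2" and nonneg: "\<And>x. g x \<ge> 0"
    and int: "\<And>k. k \<ge> 1 \<Longrightarrow> integrable shuffles_space (\<lambda>\<omega>. g (X k \<omega>))"
      "\<And>k. k \<ge> 1 \<Longrightarrow> integrable shuffles_space (\<lambda>\<omega>. g (Suc (X k \<omega>)))"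
  shows "(\<integral>\<omega>. g (X n \<omega>) \<partial>shuffles_space) = succ_mean n (\<lambda>z. \<integral>\<omega>. g (Suc (X (n - z) \<omega>)) \<partial>shuffles_space)"
proof -
  have n1: "n \<ge> 1" using n by simp
  have "ennreal (\<integral>\<omega>. g (X n \<omega>) \<partial>shuffles_space) = (\<integral>\<^sup>+\<omega>. ennreal (g (X n \<omega>)) \<partial>shuffles_space)"
    using int(1)[OF n1] nonneg by (simp add: nn_integral_eq_integral)
  also have "\<dots> = ennreal (succ_mean n (\<lambda>z. \<integral>\<omega>. g (Suc (X (n - z) \<omega>)) \<partial>shuffles_space))"
  proof (rule nn_integral_first_step[OF n1])
    show "(\<lambda>\<omega>. ennreal (g (X n \<omega>))) \<in> borel_measurable shuffles_space" by measurable
    show "(\<integral>\<^sup>+\<omega>. ennreal (g (Suc (X k \<omega>))) \<partial>shuffles_space) = ennreal (\<integral>\<omega>. g (Suc (X k \<omega>)) \<partial>shuffles_space)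
        \<and> (\<integral>\<omega>. g (Suc (X k \<omega>)) \<partial>shuffles_space) \<ge> 0" if "k \<ge> 1" for k
      using int(2)[OF that] nonneg by (simp add: nn_integral_eq_integral)
    fix p :: "nat \<Rightarrow> nat list" assume "p n \<in> permutations_of_set {1..n}"
    then have "card (blocks (p n)) \<ge> 1" using card_blocks_permutation_bounds n1 by blast
    from AE_elements_left_eq_1[OF this]
    show "AE \<omega> in shuffles_space. ennreal (g (X n (p ## \<omega>))) = ennreal (g (Suc (X (card (blocks (p n))) \<omega>)))"
      by eventually_elim (use n in \<open>simp add: X_Stream\<close>)
  qed
  finally show ?thesis
    using succ_mean_mono[of n "\<lambda>z. 0" "\<lambda>z. \<integral>\<omega>. g (Suc (X (n - z) \<omega>)) \<partial>shuffles_space"] n1 nonneg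
    by (simp add: integral_nonneg_AE)
qed

text \<open>Splitting into positive and negative parts reduces the signed case to the nonnegative
  one.\<close>

lemma integral_X_step:
  fixes g :: "nat \<Rightarrow> real"
  assumes n: "n \<ge> 2"
    and int: "\<And>k. k \<ge> 1 \<Longrightarrow> integrable shuffles_space (\<lambda>\<omega>. g (X k \<omega>))"
      "\<And>k. k \<ge> 1 \<Longrightarrow> integrable shuffles_space (\<lambda>\<omega>. g (Suc (X k \<omega>)))"
  shows "(\<integral>\<omega>. g (X n \<omega>) \<partial>shuffles_space) = succ_mean n (\<lambda>z. \<integral>\<omega>. g (Suc (X (n - z) \<omega>)) \<partial>shuffles_space)"
proof -
  define p where "p x = max (g x) 0" for x
  define q where "q x = max (- g x) 0" for x
  have g: "g x = p x - q x" for x by (auto simp: p_def q_def)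
  have ip: "integrable shuffles_space (\<lambda>\<omega>. p (X k \<omega>))" "integrable shuffles_space (\<lambda>\<omega>. p (Suc (X k \<omega>)))"
    "integrable shuffles_space (\<lambda>\<omega>. q (X k \<omega>))" "integrable shuffles_space (\<lambda>\<omega>. q (Suc (X k \<omega>)))"
    if "k \<ge> 1" for k using int[OF that] by (auto simp: p_def q_def)
  have "(\<integral>\<omega>. g (X n \<omega>) \<partial>shuffles_space) = (\<integral>\<omega>. p (X n \<omega>) \<partial>shuffles_space) - (\<integral>\<omega>. q (X n \<omega>) \<partial>shuffles_space)"
    unfolding g using ip[of n] n by (intro Bochner_Integration.integral_diff) auto
  also have "\<dots> = succ_mean n (\<lambda>z. (\<integral>\<omega>. p (Suc (X (n - z) \<omega>)) \<partial>shuffles_space)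
    - (\<integral>\<omega>. q (Suc (X (n - z) \<omega>)) \<partial>shuffles_space))"
    unfolding succ_mean_diff using ip n
    by (intro arg_cong2[where f = "(-)"] integral_X_nonneg_step) (auto simp: p_def q_def)
  also have "\<dots> = succ_mean n (\<lambda>z. \<integral>\<omega>. g (Suc (X (n - z) \<omega>)) \<partial>shuffles_space)"
    unfolding g using ip n
    by (intro succ_mean_cong Bochner_Integration.integral_diff[symmetric]) auto
  finally show ?thesis .
qed

interpretation merging: moment_recursion \<mu> central_moment
proof
  have int1: "integrable shuffles_space (\<lambda>\<omega>. real (X n \<omega>))" if "n \<ge> 1" for n
    using integrable_X_power[OF that, of 1] by simp
  fix n :: nat
  show "central_moment 0 n = 1" by (simp add: central_moment_def shuffles.prob_space[simplified])
  show "central_moment (Suc 0) n = 0" if "n \<ge> 1"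
    using int1[OF that] by (simp add: central_moment_def \<mu>_def shuffles.prob_space[simplified])
  assume n: "n \<ge> 2"
  have "\<mu> n = succ_mean n (\<lambda>z. \<integral>\<omega>. real (Suc (X (n - z) \<omega>)) \<partial>shuffles_space)"
    unfolding \<mu>_def using n int1 by (intro integral_X_step) auto
  also have "\<dots> = succ_mean n (\<lambda>z. 1 + \<mu> (n - z))"
    using n int1 by (intro succ_mean_cong) (auto simp: \<mu>_def shuffles.prob_space[simplified])
  finally show "\<mu> n = 1 + succ_mean n (\<lambda>z. \<mu> (n - z))"
    by (simp add: succ_mean_add)
  fix m :: nat
  have "central_moment m n = succ_mean n (\<lambda>z. \<integral>\<omega>. (real (Suc (X (n - z) \<omega>)) - \<mu> n) ^ m \<partial>shuffles_space)"
    unfolding central_moment_def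
  proof (rule integral_X_step[OF n])
    fix k :: nat assume k: "k \<ge> 1"
    show "integrable shuffles_space (\<lambda>\<omega>. (real (X k \<omega>) - \<mu> n) ^ m)"
      using integrable_X_centered_power[OF k, of "- \<mu> n"] by simp
    show "integrable shuffles_space (\<lambda>\<omega>. (real (Suc (X k \<omega>)) - \<mu> n) ^ m)"
      using integrable_X_centered_power[OF k, of "1 - \<mu> n"] by (simp add: algebra_simps)
  qed
  also have "\<dots> = succ_mean n (\<lambda>z. \<Sum>j\<le>m. real (m choose j) * central_moment j (n - z) * (1 + \<mu> (n - z)
    - \<mu> n) ^ (m - j))"
  proof (rule succ_mean_cong)
    fix z assume z: "z < n"
    let ?k = "n - z"
    have k: "?k \<ge> 1" using z by simp
    have "(real (Suc (X ?k \<omega>)) - \<mu> n) ^ m =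
        (\<Sum>j\<le>m. (real (m choose j) * (1 + \<mu> ?k - \<mu> n) ^ (m - j)) * (real (X ?k \<omega>) - \<mu> ?k) ^ j)" for \<omega>
    proof -
      \<comment> \<open>Recentring at the mean of the process restarted from \<open>?k\<close>
        elements, so that central moments reappear.\<close>
      have "(real (Suc (X ?k \<omega>)) - \<mu> n) ^ m = ((real (X ?k \<omega>) - \<mu> ?k) + (1 + \<mu> ?k - \<mu> n)) ^ m"
        by (simp add: algebra_simps)
      also have "\<dots> = (\<Sum>j\<le>m. (real (m choose j) * (1 + \<mu> ?k - \<mu> n) ^ (m - j)) * (real (X ?k \<omega>) - \<mu> ?k) ^ j)"
        unfolding binomial_ring by (simp only: mult_ac)
      finally show ?thesis .
    qed
    moreover have "integrable shuffles_space (\<lambda>\<omega>. (real (X ?k \<omega>) - \<mu> ?k) ^ j)" for j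
      using integrable_X_centered_power[OF k, of "- \<mu> ?k"] by simp
    ultimately show "(\<integral>\<omega>. (real (Suc (X ?k \<omega>)) - \<mu> n) ^ m \<partial>shuffles_space)
       = (\<Sum>j\<le>m. real (m choose j) * central_moment j ?k * (1 + \<mu> ?k - \<mu> n) ^ (m - j))"
      by (simp add: central_moment_def mult_ac)
  qed (use n in simp)
  finally show "central_moment m n =
      succ_mean n (\<lambda>z. \<Sum>j\<le>m. real (m choose j) * central_moment j (n - z) * (1 + \<mu> (n - z) - \<mu> n) ^ (m - j))" .
qed

lemma err_rate_bigo:
  assumes "\<And>n. n \<ge> 2 \<Longrightarrow> \<bar>f n\<bar> \<le> K * err_rate (Suc (Suc M)) n"
  shows "f \<in> O(\<lambda>n. real n ^ M * ln (real n))"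
proof (rule bigoI)
  show "eventually (\<lambda>n. norm (f n) \<le> (2 * \<bar>K\<bar>) * norm (real n ^ M * ln (real n))) sequentially"
    using eventually_ge_at_top[of 3]
  proof eventually_elim
    case (elim n)
    \<comment> \<open>From \<open>n = 3\<close> on \<open>ln n \<ge> 1\<close>, hence
      \<open>1 + ln n \<le> 2 * ln n\<close>.\<close>
    have "exp 1 \<le> real n" using exp_le elim by linarith
    then have ln: "ln (real n) \<ge> 1" using elim by (subst ln_ge_iff) auto
    have "\<bar>f n\<bar> \<le> K * err_rate (Suc (Suc M)) n" using assms elim by simp
    also have "\<dots> \<le> \<bar>K\<bar> * err_rate (Suc (Suc M)) n"
      using elim by (intro mult_right_mono err_rate_nonneg) auto
    also have "\<dots> \<le> \<bar>K\<bar> * (real n ^ M * (2 * ln (real n)))"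
      unfolding err_rate_ge2 using ln by (intro mult_left_mono) auto
    finally show ?case using ln by (simp add: abs_mult mult_ac)
  qed
qed

theorem theorem5p1:
  fixes m :: nat
  assumes "m \<ge> 2"
  shows "(\<forall>n\<ge>1. (AE \<omega> in shuffles_space. \<exists>t. elements_left n \<omega> t = 1) \<and>
            integrable shuffles_space (\<lambda>\<omega>. real (X n \<omega>)) \<and>
            integrable shuffles_space (\<lambda>\<omega>. (real (X n \<omega>) - \<mu> n) ^ m)) \<and>
         (\<lambda>n. central_moment m n - main_term m n)
            \<in> O(\<lambda>n. real n ^ (m div 2 - 1) * ln (real n)) \<and>
         (m = 2 \<or> m = 3 \<longrightarrow> (\<lambda>n. \<bar>\<epsilon> m n - \<epsilon> m (n - 1)\<bar>) \<in> O(\<lambda>n. 1 / real n)) \<and>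
         (m \<ge> 4 \<longrightarrow> (\<lambda>n. \<bar>\<epsilon> m n - \<epsilon> m (n - 1)\<bar>)
            \<in> O(\<lambda>n. real n ^ (m div 2 - 2) * ln (real n)))"
proof (intro conjI allI impI)
  fix n :: nat assume n: "n \<ge> 1"
  show "AE \<omega> in shuffles_space. \<exists>t. elements_left n \<omega> t = 1"
    by (rule AE_elements_left_eq_1[OF n])
  show "integrable shuffles_space (\<lambda>\<omega>. real (X n \<omega>))"
    using integrable_X_power[OF n, of 1] by simp
  show "integrable shuffles_space (\<lambda>\<omega>. (real (X n \<omega>) - \<mu> n) ^ m)"
    using integrable_X_centered_power[OF n, of "- \<mu> n"] by simp
next
  obtain K where K: "\<And>n. n \<ge> 2 \<Longrightarrow> \<bar>central_moment m n - main_term m n\<bar> \<le> K * err_rate (Suc (m div 2)) n"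
    using merging.err_bound[of m] unfolding merging.err_def by blast
  have "Suc (m div 2) = Suc (Suc (m div 2 - 1))" using assms by simp
  from K[unfolded this] show "(\<lambda>n. central_moment m n - main_term m n)
      \<in> O(\<lambda>n. real n ^ (m div 2 - 1) * ln (real n))"
    by (rule err_rate_bigo)
next
  obtain K where K: "\<And>n. n \<ge> 2 \<Longrightarrow> \<bar>\<epsilon> m n - \<epsilon> m (n - 1)\<bar> \<le> K * err_rate (m div 2) n"
    using merging.err_increments[OF assms] unfolding merging.err_def \<epsilon>_def by blast
  {
    assume "m = 2 \<or> m = 3"
    \<comment> \<open>At this order the increments have the plain rate \<open>1 / n\<close>; the
      logarithm appears only after summation.\<close>
    then have "m div 2 = Suc 0" by auto
    with K have "\<And>n. n \<ge> 2 \<Longrightarrow> \<bar>\<epsilon> m n - \<epsilon> m (n - 1)\<bar> \<le> K * (1 / real n)"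
      by (simp add: err_rate_1)
    then show "(\<lambda>n. \<bar>\<epsilon> m n - \<epsilon> m (n - 1)\<bar>) \<in> O(\<lambda>n. 1 / real n)"
      by (intro bigoI[where c = K] eventually_sequentiallyI[of 2]) simp
  next
    assume "m \<ge> 4"
    then have "m div 2 = Suc (Suc (m div 2 - 2))" by simp
    then have "\<bar>\<bar>\<epsilon> m n - \<epsilon> m (n - 1)\<bar>\<bar> \<le> K * err_rate (Suc (Suc (m div 2 - 2))) n" if "n \<ge> 2" for n
      using K[OF that] by simp
    then show "(\<lambda>n. \<bar>\<epsilon> m n - \<epsilon> m (n - 1)\<bar>)
        \<in> O(\<lambda>n. real n ^ (m div 2 - 2) * ln (real n))"
      by (rule err_rate_bigo)
  }
qed

end
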